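(* For each integer $n\ge 2$, let $X_0,\dots,X_{n-1}$ be independent random variables with $\mathbb{P}(X_k=1)=\mathbb{P}(X_k=-1)=\tfrac12$, and let $P(z)=\sum_{k=0}^{n-1}X_kz^k$. Then the Mahler measure $M(P)$ satisfies $$\frac{M(P)}{\sqrt n}\to e^{-\gamma/2}\quad\text{in probability, as } n\to\infty,$$ where $\gamma\approx 0.5772$ is Euler's constant.
   Context: The Mahler measure $M(F)$ of a nonzero polynomial $F$ is given by $\log M(F)=\int_{-\pi}^{\pi}\log|F(e^{i\theta})|\,d\mu(\theta)$, where $d\mu(\theta)=d\theta/(2\pi)$ on $[-\pi,\pi]$. For a polynomial whose leading coefficient has absolute value $1$ and whose roots, with multiplicity, are $\alpha_1,\dots,\alpha_m$, this equals $M(F)=\prod_{j=1}^{m}\max\{1,|\alpha_j|\}$. *)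

theory Defs
  imports "HOL-Probability.Probability" "HOL-Computational_Algebra.Polynomial"
begin

(* The zero polynomial gets the usual convention M(0) = 0.  For p \<noteq> 0 the logarithm is
   integrable and the finitely many zeros on the circle (where ln 0 = 0 in HOL) form a null set. *)
definition mahler_measure :: "complex poly \<Rightarrow> real" where
  "mahler_measure p =
     (if p = 0 then 0
      else exp ((LBINT \<theta>:{-pi..pi}. ln (cmod (poly p (cis \<theta>)))) / (2 * pi)))"

definition random_poly :: "nat \<Rightarrow> (nat \<Rightarrow> 'a \<Rightarrow> real) \<Rightarrow> 'a \<Rightarrow> complex poly" where
  "random_poly n X \<omega> = (\<Sum>k<n. monom (complex_of_real (X k \<omega>)) k)"

(* The n-th variable may live on its own space M n.  Measurability is part of the notion because
   measure is 0 on non-measurable sets; it is only required eventually, so that finitely many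
   initial indices play no role. *)
definition tendsto_in_probability ::
    "(nat \<Rightarrow> 'a measure) \<Rightarrow> (nat \<Rightarrow> 'a \<Rightarrow> real) \<Rightarrow> real \<Rightarrow> bool" where
  "tendsto_in_probability M Y c \<longleftrightarrow>
     (\<forall>\<^sub>F n in sequentially. Y n \<in> borel_measurable (M n)) \<and>
     (\<forall>\<epsilon>>0. (\<lambda>n. measure (M n) {\<omega> \<in> space (M n). \<bar>Y n \<omega> - c\<bar> > \<epsilon>}) \<longlonglongrightarrow> 0)"

end

theory Submission
  imports Defs "HOL-Computational_Algebra.Fundamental_Theorem_Algebra" "HOL-Real_Asymp.Real_Asymp"
begin

text \<open>
  Write S(z) for the random polynomial with n signs, M for its Mahler measure, and
  Y = |S(z)|^2 / n for a point z = cis t of the circle. By the central limit theorem S(z) / sqrt n is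
  asymptotically a standard complex Gaussian for all z other than 1 and -1, so Y is asymptotically
  exponentially distributed, and its values at two generic points of the circle are asymptotically
  independent. Hence the average of a bounded continuous function of Y over the
  circle concentrates at its expectation under the exponential law. Applied to the logarithm this
  says that 2 log M - log n, which is the average of ln Y over the circle, should converge to the
  integral of ln y exp (- y) over y > 0, that is to Gamma'(1) = - euler_mascheroni, and the theorem is
  the exponential of one half of this. As the logarithm is unbounded, both of its tails have to be
  cut off; the upper one is harmless because Y has mean one, and the lower one carries the difficulty.

  All probabilities reduce to finite averages over sign vectors (\<open>sign_mean\<close>, \<open>prob_le_sign_mean\<close>).
  Both probabilistic inputs come from one identity, \<open>sign_mean_exp_quadratic\<close>: the average of
  exp (- Q / 2), for a sum Q of squares of linear forms in the signs, is a Gaussian integral of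
  a product of cosines.

  \<^item> Limit law. With four linear forms (real and imaginary parts at two points) dominated convergence
    in the Gaussian integral gives \<open>two_point_clt\<close>. A second moment computation turns it into
    concentration of the Laplace transforms of Y (\<open>laplace_tendsto_L1\<close>), and Weierstrass approximation
    in the variable exp (- Y) extends it to continuous functions (\<open>circle_average_tendsto_L1\<close>).

  \<^item> Lower tail. The product of cosines is estimated by the AM-GM inequality over blocks of r
    consecutive factors. The resulting powers of cosines belong to a walk that uses only
    the r steps 1, z, ..., z^(r-1) many times each (\<open>block_comparison\<close>). With r = 1 this bounds the
    probability of Y \<le> e by a multiple of sqrt e + 1 / sqrt n at every point. That is enough for
    the values of ln Y down to - 13 ln n, but there may be arcs on which S is smaller still. Their
    total length is controlled by r = 3, averaged over the circle: three independent sums of signs vanish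
    together with probability of order n^(-3/2), and otherwise one meets a nonzero quadratic
    polynomial with integer coefficients, which is rarely small on the circle. Factoring S
    into n - 1 linear factors, each with an integrable logarithm, bounds the integral of - ln Y over
    these arcs by a multiple of n ln n times their length, up to a vanishing error
    (\<open>log_deep_bound\<close>), and this tends to zero since 3/2 > 1. The sum of both contributions
    is \<open>lower_tail\<close>.
\<close>

section \<open>Averages over independent signs\<close>

definition signs :: "nat \<Rightarrow> (nat \<Rightarrow> real) set" where
  "signs n = PiE {..<n} (\<lambda>_. {-1, 1})"

definition sign_mean :: "nat \<Rightarrow> ((nat \<Rightarrow> real) \<Rightarrow> real) \<Rightarrow> real" where
  "sign_mean n f = (\<Sum>x\<in>signs n. f x) / 2 ^ n"

lemma finite_signs [simp]: "finite (signs n)"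
  by (simp add: signs_def finite_PiE)

lemma card_signs: "card (signs n) = 2 ^ n"
  by (simp add: signs_def card_PiE numeral_2_eq_2)

lemma signs_cases: "x \<in> signs n \<Longrightarrow> k < n \<Longrightarrow> x k = -1 \<or> x k = 1"
  by (auto simp: signs_def PiE_iff)

lemma sign_mean_const [simp]: "sign_mean n (\<lambda>x. c) = c"
  by (simp add: sign_mean_def card_signs)

lemma sign_mean_add: "sign_mean n (\<lambda>x. f x + g x) = sign_mean n f + sign_mean n g"
  by (simp add: sign_mean_def sum.distrib add_divide_distrib)

lemma sign_mean_diff: "sign_mean n (\<lambda>x. f x - g x) = sign_mean n f - sign_mean n g"
  by (simp add: sign_mean_def sum_subtractf diff_divide_distrib)

lemma sign_mean_cmult: "sign_mean n (\<lambda>x. c * f x) = c * sign_mean n f"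
  by (simp add: sign_mean_def sum_distrib_left)

lemma sign_mean_divide: "sign_mean n (\<lambda>x. f x / c) = sign_mean n f / c"
  using sign_mean_cmult[of n "inverse c" f] by (simp add: divide_inverse mult.commute)

lemma sign_mean_sum: "sign_mean n (\<lambda>x. \<Sum>i\<in>I. f i x) = (\<Sum>i\<in>I. sign_mean n (f i))"
  by (induction I rule: infinite_finite_induct) (simp_all add: sign_mean_add)

lemma sign_mean_mono: "(\<And>x. x \<in> signs n \<Longrightarrow> f x \<le> g x) \<Longrightarrow> sign_mean n f \<le> sign_mean n g"
  by (simp add: sign_mean_def sum_mono divide_right_mono)

lemma sign_mean_cong: "(\<And>x. x \<in> signs n \<Longrightarrow> f x = g x) \<Longrightarrow> sign_mean n f = sign_mean n g"
  by (simp add: sign_mean_def)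

lemma sign_mean_nonneg: "(\<And>x. x \<in> signs n \<Longrightarrow> 0 \<le> f x) \<Longrightarrow> 0 \<le> sign_mean n f"
  by (simp add: sign_mean_def sum_nonneg)

lemma sign_mean_abs: "\<bar>sign_mean n f\<bar> \<le> sign_mean n (\<lambda>x. \<bar>f x\<bar>)"
  unfolding sign_mean_def by (simp add: divide_right_mono)

lemma sign_mean_0 [simp]: "sign_mean 0 f = f (\<lambda>_. undefined)"
  by (simp add: sign_mean_def signs_def)

lemma sign_mean_Suc:
  "sign_mean (Suc n) f = (sign_mean n (\<lambda>x. f (x(n := 1))) + sign_mean n (\<lambda>x. f (x(n := -1)))) / 2"
proof -
  let ?h = "\<lambda>(y, g). g(n := y) :: nat \<Rightarrow> real"
  have inj: "inj_on ?h ({-1, 1} \<times> signs n)"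
  proof (rule inj_onI, clarify)
    fix a b g h assume "g \<in> signs n" "h \<in> signs n" and eq: "g(n := a) = h(n := b)"
    then have "g n = undefined" "h n = undefined"
      by (auto simp: signs_def PiE_iff extensional_def)
    moreover have "g k = h k" if "k \<noteq> n" for k
      using fun_cong[OF eq, of k] that by simp
    ultimately show "a = b \<and> g = h"
      using fun_cong[OF eq, of n] by (metis ext fun_upd_same)
  qed
  have "signs (Suc n) = ?h ` ({-1, 1} \<times> signs n)"
    unfolding signs_def lessThan_Suc by (rule PiE_insert_eq)
  then have "(\<Sum>x\<in>signs (Suc n). f x) = (\<Sum>(y, g)\<in>{-1, 1} \<times> signs n. f (g(n := y)))"
    by (simp only: sum.reindex[OF inj]) (simp add: case_prod_unfold)
  also have "\<dots> = (\<Sum>g\<in>signs n. f (g(n := 1))) + (\<Sum>g\<in>signs n. f (g(n := -1)))"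
    by (simp add: sum.cartesian_product[symmetric])
  finally show ?thesis
    by (simp add: sign_mean_def field_simps)
qed

lemma sign_mean_integral:
  assumes "\<And>x. x \<in> signs n \<Longrightarrow> integrable M (\<lambda>t. f t x)"
  shows "(\<integral>t. sign_mean n (f t) \<partial>M) = sign_mean n (\<lambda>x. \<integral>t. f t x \<partial>M)"
  unfolding sign_mean_def using assms by (simp add: Bochner_Integration.integral_sum)

text \<open>Consecutive blocks of signs are independent.\<close>

lemma sign_mean_split:
  "sign_mean (m + n) f
     = sign_mean m (\<lambda>x. sign_mean n (\<lambda>y. f (\<lambda>k. if k < m then x k else y (k - m))))"
proof (induction n arbitrary: f)
  case 0
  have "f (\<lambda>k. if k < m then x k else undefined) = f x" if "x \<in> signs m" for x
    by (rule arg_cong[where f = f]) (use that in \<open>auto simp: signs_def PiE_iff extensional_def\<close>)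
  then have "sign_mean m (\<lambda>x. f (\<lambda>k. if k < m then x k else undefined)) = sign_mean m f"
    by (rule sign_mean_cong)
  then show ?case by simp
next
  case (Suc n)
  have upd: "(\<lambda>k. if k < m then x k else y (k - m))(m + n := c)
      = (\<lambda>k. if k < m then x k else (y(n := c)) (k - m))" for x y :: "nat \<Rightarrow> real" and c
    by (auto simp: fun_eq_iff)
  show ?case
    by (simp add: sign_mean_Suc Suc.IH upd sign_mean_add sign_mean_divide)
qed

text \<open>The characteristic function of a sum of independent signs, which is real by symmetry. A phase c
  makes the statement inductive, because cos (c + t) + cos (c - t) = 2 cos c cos t.\<close>

lemma sign_mean_cos:
  "sign_mean n (\<lambda>x. cos (\<Sum>k<n. t k * x k)) = (\<Prod>k<n. cos (t k))"
proof -
  have "sign_mean n (\<lambda>x. cos (c + (\<Sum>k<n. t k * x k))) = cos c * (\<Prod>k<n. cos (t k))" for c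
  proof (induction n arbitrary: c)
    case (Suc n)
    have *: "(\<Sum>k<n. t k * (x(n := e)) k) = (\<Sum>k<n. t k * x k)" for x e
      by (intro sum.cong) auto
    have "sign_mean (Suc n) (\<lambda>x. cos (c + (\<Sum>k<Suc n. t k * x k)))
        = (sign_mean n (\<lambda>x. cos ((c + t n) + (\<Sum>k<n. t k * x k)))
           + sign_mean n (\<lambda>x. cos ((c - t n) + (\<Sum>k<n. t k * x k)))) / 2"
      by (simp add: sign_mean_Suc * algebra_simps del: fun_upd_apply) (simp add: algebra_simps)
    also have "\<dots> = (cos (c + t n) + cos (c - t n)) / 2 * (\<Prod>k<n. cos (t k))"
      by (simp only: Suc.IH) (simp add: algebra_simps)
    also have "\<dots> = cos c * (\<Prod>k<Suc n. cos (t k))"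
      by (simp add: cos_add cos_diff)
    finally show ?case .
  qed simp
  from this[of 0] show ?thesis by simp
qed

lemma sign_mean_of_sum:
  "sign_mean m (\<lambda>x. F (\<Sum>k<m. x k))
     = (\<Sum>j\<le>m. real (m choose j) / 2 ^ m * F (2 * real j - real m))"
proof (induction m arbitrary: F)
  case (Suc m)
  have *: "(\<Sum>k<m. (x(m := e)) k) = (\<Sum>k<m. x k)" for x :: "nat \<Rightarrow> real" and e
    by (intro sum.cong) auto
  define G where "G j = F (2 * real j - real (Suc m))" for j
  have "sign_mean (Suc m) (\<lambda>x. F (\<Sum>k<Suc m. x k))
     = (sign_mean m (\<lambda>x. F ((\<Sum>k<m. x k) + 1)) + sign_mean m (\<lambda>x. F ((\<Sum>k<m. x k) - 1))) / 2"
    by (simp add: sign_mean_Suc *)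
  also have "\<dots> = ((\<Sum>j\<le>m. real (m choose j) / 2 ^ m * G (Suc j))
                 + (\<Sum>j\<le>m. real (m choose j) / 2 ^ m * G j)) / 2"
    by (simp only: Suc.IH[of "\<lambda>s. F (s + 1)"] Suc.IH[of "\<lambda>s. F (s - 1)"])
       (simp add: G_def algebra_simps)
  also have "\<dots> = ((\<Sum>j\<le>m. real (m choose j) * G (Suc j)) + (\<Sum>j\<le>m. real (m choose j) * G j)) / 2 ^ Suc m"
    by (simp add: sum_divide_distrib add_divide_distrib mult.commute)
  also have "(\<Sum>j\<le>m. real (m choose j) * G j) = (\<Sum>j\<le>Suc m. real (m choose j) * G j)"
    by simp
  also have "\<dots> = G 0 + (\<Sum>j\<le>m. real (m choose Suc j) * G (Suc j))"
    by (subst sum.atMost_Suc_shift) simp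
  also have "(\<Sum>j\<le>m. real (m choose j) * G (Suc j)) + (G 0 + (\<Sum>j\<le>m. real (m choose Suc j) * G (Suc j)))
      = G 0 + (\<Sum>j\<le>m. real (Suc m choose Suc j) * G (Suc j))"
    by (simp add: sum.distrib[symmetric] algebra_simps)
  also have "\<dots> = (\<Sum>j\<le>Suc m. real (Suc m choose j) * G j)"
    by (subst sum.atMost_Suc_shift) simp
  finally show ?case
    by (simp add: G_def sum_divide_distrib add_divide_distrib)
qed simp

text \<open>From h to h + 1 the square of the left side is multiplied by ((2h+1)/(2h+2))^2, which is at most
  (2h+1)/(2h+3). This is the order 1 / sqrt n of every small ball probability below.\<close>

lemma central_binomial_upper_bound: "real ((2 * h) choose h) / 2 ^ (2 * h) \<le> 1 / sqrt (2 * real h + 1)"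
proof (induction h)
  case (Suc h)
  have rec: "real ((2 * Suc h) choose Suc h) = real ((2 * h) choose h) * (2 * (2 * real h + 1) / (real h + 1))"
  proof -
    have 1: "Suc h * ((2 * Suc h) choose Suc h) = 2 * Suc h * (Suc (2 * h) choose h)"
      using Suc_times_binomial[of h "Suc (2 * h)"] by simp
    have 2: "Suc h * (Suc (2 * h) choose h) = Suc (2 * h) * ((2 * h) choose h)"
      using binomial_absorb_comp[of "Suc (2 * h)" h] by simp
    have "(real h + 1) * real ((2 * Suc h) choose Suc h) = 2 * (real h + 1) * real (Suc (2 * h) choose h)"
      using arg_cong[OF 1, of real] by (simp add: algebra_simps)
    moreover have "(real h + 1) * real (Suc (2 * h) choose h) = (2 * real h + 1) * real ((2 * h) choose h)"
      using arg_cong[OF 2, of real] by (simp add: algebra_simps)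
    ultimately have "(real h + 1) * real ((2 * Suc h) choose Suc h) = 2 * ((2 * real h + 1) * real ((2 * h) choose h))"
      by (metis mult.assoc)
    then show ?thesis by (simp add: field_simps)
  qed
  let ?r = "(2 * real h + 1) / (2 * real h + 2)"
  have "real ((2 * Suc h) choose Suc h) / 2 ^ (2 * Suc h) = real ((2 * h) choose h) / 2 ^ (2 * h) * ?r"
    unfolding rec by (simp add: divide_simps) (simp add: algebra_simps)
  also have "\<dots> \<le> 1 / sqrt (2 * real h + 1) * ?r"
    by (intro mult_right_mono Suc.IH) auto
  also have "\<dots> = sqrt (2 * real h + 1) / (2 * real h + 2)"
    using real_div_sqrt[of "2 * real h + 1"] by (simp add: divide_divide_eq_left' mult.commute)
  also have "\<dots> \<le> 1 / sqrt (2 * real h + 3)"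
  proof -
    have "sqrt (2 * real h + 1) * sqrt (2 * real h + 3) \<le> sqrt ((2 * real h + 2)\<^sup>2)"
      unfolding real_sqrt_mult[symmetric]
      by (intro real_sqrt_le_mono) (simp add: power2_eq_square algebra_simps)
    then show ?thesis by (simp add: field_simps)
  qed
  finally show ?case by (simp add: algebra_simps)
qed simp

section \<open>Gaussian linearisation\<close>

definition gauss :: "nat \<Rightarrow> (nat \<Rightarrow> real) measure" where
  "gauss d = PiM {..<d} (\<lambda>_. std_normal_distribution)"

interpretation std_normal: prob_space std_normal_distribution
  by (rule prob_space_normal_density) simp

interpretation std_normal_product: product_prob_space "\<lambda>_::nat. std_normal_distribution" UNIV
  by unfold_locales

lemma prob_space_gauss: "prob_space (gauss d)"
  unfolding gauss_def by (intro prob_space_PiM std_normal.prob_space_axioms)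

lemma measurable_gauss_component:
  "i < d \<Longrightarrow> (\<lambda>g. g i) \<in> borel_measurable (gauss d)"
proof -
  assume "i < d"
  then have "(\<lambda>g. g i) \<in> measurable (gauss d) std_normal_distribution"
    unfolding gauss_def by (intro measurable_component_singleton) auto
  then show ?thesis by simp
qed

lemma gauss_integral_prod:
  fixes f :: "nat \<Rightarrow> real \<Rightarrow> 'b :: {real_normed_field, banach, second_countable_topology}"
  assumes "\<And>i. i < d \<Longrightarrow> integrable std_normal_distribution (f i)"
  shows "(\<integral>g. (\<Prod>i<d. f i (g i)) \<partial>gauss d) = (\<Prod>i<d. \<integral>u. f i u \<partial>std_normal_distribution)"
  unfolding gauss_def by (rule std_normal_product.product_integral_prod) (use assms in auto)

lemma gauss_integral_cos:
  "(\<integral>g. cos (\<Sum>i<d. g i * u i) \<partial>gauss d) = exp (- (\<Sum>i<d. (u i)\<^sup>2) / 2)"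
proof -
  note measurable_gauss_component [measurable]
  interpret prob_space "gauss d" by (rule prob_space_gauss)
  have [simp]: "integrable std_normal_distribution
      (\<lambda>x. exp (\<i> * (complex_of_real t * complex_of_real x)))" for t
    using std_normal.integrable_iexp[of "\<lambda>x. complex_of_real (t * x)"] by simp
  have eq: "(\<Prod>i<d. iexp (u i * g i)) = iexp (\<Sum>i<d. g i * u i)" for g
    by (simp add: exp_sum[symmetric] sum_distrib_left mult.commute)
  have "(\<integral>g. iexp (\<Sum>i<d. g i * u i) \<partial>gauss d) = (\<Prod>i<d. char std_normal_distribution (u i))"
    unfolding eq[symmetric] char_def
    by (subst gauss_integral_prod) simp_all
  also have "\<dots> = of_real (exp (- (\<Sum>i<d. (u i)\<^sup>2) / 2))"
    unfolding char_std_normal_distribution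
    by (simp add: exp_sum[symmetric] of_real_prod[symmetric] sum_negf sum_divide_distrib del: of_real_prod)
  finally have "Re (\<integral>g. iexp (\<Sum>i<d. g i * u i) \<partial>gauss d) = exp (- (\<Sum>i<d. (u i)\<^sup>2) / 2)"
    by simp
  moreover have "integrable (gauss d) (\<lambda>g. iexp (\<Sum>i<d. g i * u i))"
    by (intro integrable_const_bound[where B = 1]) auto
  ultimately show ?thesis
    by (subst (asm) integral_Re[symmetric]) (auto simp: exp_eq_polar)
qed

text \<open>The identity behind both the limit theorem and the small ball estimates. Since exp (- u^2 / 2) is
  the Fourier transform of the Gaussian law, the quadratic form becomes a linear one in the signs
  under the integral over g, and the average over independent signs factors.\<close>

lemma sign_mean_exp_quadratic:
  "sign_mean n (\<lambda>x. exp (- (\<Sum>i<d. (\<Sum>k<n. a i k * x k)\<^sup>2) / 2))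
     = (\<integral>g. (\<Prod>k<n. cos (\<Sum>i<d. g i * a i k)) \<partial>gauss d)"
proof -
  note measurable_gauss_component [measurable]
  interpret prob_space "gauss d" by (rule prob_space_gauss)
  have swap: "(\<Sum>i<d. g i * (\<Sum>k<n. a i k * x k)) = (\<Sum>k<n. (\<Sum>i<d. g i * a i k) * x k)"
    for g x :: "nat \<Rightarrow> real"
    by (simp add: sum_distrib_left sum_distrib_right mult.assoc sum.swap[of _ "{..<d}"])
  have "(\<integral>g. (\<Prod>k<n. cos (\<Sum>i<d. g i * a i k)) \<partial>gauss d)
      = (\<integral>g. sign_mean n (\<lambda>x. cos (\<Sum>i<d. g i * (\<Sum>k<n. a i k * x k))) \<partial>gauss d)"
    by (simp add: swap sign_mean_cos)
  also have "\<dots> = sign_mean n (\<lambda>x. \<integral>g. cos (\<Sum>i<d. g i * (\<Sum>k<n. a i k * x k)) \<partial>gauss d)"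
    by (intro sign_mean_integral integrable_const_bound[where B = 1]) auto
  finally show ?thesis by (simp add: gauss_integral_cos)
qed

lemma gauss_integral_exp_neg_square:
  assumes "\<And>i. i < d \<Longrightarrow> 0 \<le> s i"
  shows "(\<integral>g. exp (- (\<Sum>i<d. s i * (g i)\<^sup>2) / 2) \<partial>gauss d) = (\<Prod>i<d. 1 / sqrt (1 + s i))"
proof -
  have one: "(\<integral>u. exp (- (c * u\<^sup>2) / 2) \<partial>std_normal_distribution) = 1 / sqrt (1 + c)" if "0 \<le> c" for c
  proof -
    let ?\<sigma> = "1 / sqrt (1 + c)"
    have [simp]: "?\<sigma>\<^sup>2 = 1 / (1 + c)" using that by (simp add: power_divide)
    have eq: "std_normal_density u * exp (- (c * u\<^sup>2) / 2) = ?\<sigma> * normal_density 0 ?\<sigma> u" for u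
      using that by (simp add: normal_density_def exp_add[symmetric] real_sqrt_divide real_sqrt_mult field_simps)
    have "(\<integral>u. exp (- (c * u\<^sup>2) / 2) \<partial>std_normal_distribution)
        = (\<integral>u. ?\<sigma> * normal_density 0 ?\<sigma> u \<partial>lborel)"
      unfolding eq[symmetric] by (subst integral_density) auto
    also have "\<dots> = ?\<sigma>"
      using that integral_normal_density[of ?\<sigma> 0] by simp
    finally show ?thesis .
  qed
  have "exp (- (\<Sum>i<d. s i * (g i)\<^sup>2) / 2) = (\<Prod>i<d. exp (- (s i * (g i)\<^sup>2) / 2))" for g
    by (simp add: exp_sum[symmetric] sum_negf sum_divide_distrib)
  moreover have "integrable std_normal_distribution (\<lambda>u. exp (- (s i * u\<^sup>2) / 2))" if "i < d" for i
    by (intro std_normal.integrable_const_bound[where B = 1]) (use assms[OF that] in auto)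
  ultimately show ?thesis
    by (simp only: gauss_integral_prod[where f = "\<lambda>i u. exp (- (s i * u\<^sup>2) / 2)"])
       (intro prod.cong refl one assms, simp)
qed

section \<open>Comparison with a walk with few distinct steps\<close>

definition walk :: "nat \<Rightarrow> (nat \<Rightarrow> real) \<Rightarrow> complex \<Rightarrow> complex" where
  "walk n x z = (\<Sum>k<n. of_real (x k) * z ^ k)"

lemma sign_mean_exp_cmod:
  "sign_mean n (\<lambda>x. exp (- (l * cmod (\<Sum>k<n. of_real (x k) * c k))\<^sup>2 / 2))
     = (\<integral>g. (\<Prod>k<n. cos (l * (g 0 * Re (c k) + g 1 * Im (c k)))) \<partial>gauss 2)"
proof -
  have two: "{..<2} = {0, 1 :: nat}" by auto
  define a where "a i k = l * (if i = 0 then Re (c k) else Im (c k))" for i k :: nat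
  have "(\<Sum>i<2. (\<Sum>k<n. a i k * x k)\<^sup>2) = (l * cmod (\<Sum>k<n. of_real (x k) * c k))\<^sup>2" for x :: "nat \<Rightarrow> real"
  proof -
    have "(\<Sum>k<n. a 0 k * x k) = l * Re (\<Sum>k<n. of_real (x k) * c k)"
         "(\<Sum>k<n. a 1 k * x k) = l * Im (\<Sum>k<n. of_real (x k) * c k)"
      by (simp_all add: a_def sum_distrib_left mult_ac)
    then show ?thesis
      by (simp add: two power_mult_distrib cmod_power2 distrib_left)
  qed
  moreover have "(\<Sum>i<2. g i * a i k) = l * (g 0 * Re (c k) + g 1 * Im (c k))" for g k
    by (simp add: two a_def algebra_simps)
  ultimately show ?thesis
    using sign_mean_exp_quadratic[where n = n and d = 2 and a = a] by simp
qed

lemma prod_le_mean_power: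
  fixes y :: "nat \<Rightarrow> real"
  assumes "0 < m" and y: "\<And>j. j < m \<Longrightarrow> 0 \<le> y j"
  shows "(\<Prod>j<m. y j) \<le> (\<Sum>j<m. y j ^ m) / m"
proof -
  have "(\<Prod>j<m. y j ^ m) powr (1 / m) = (\<Prod>j<m. y j)"
  proof -
    have "(\<Prod>j<m. y j ^ m) = (\<Prod>j<m. y j) ^ m" by (simp add: prod_power_distrib)
    also have "\<dots> = (\<Prod>j<m. y j) powr m"
      using \<open>0 < m\<close> y by (intro powr_realpow'[symmetric] prod_nonneg) auto
    finally show ?thesis
      using \<open>0 < m\<close> y prod_nonneg[of "{..<m}" y] by (simp add: powr_powr)
  qed
  moreover have "(\<Prod>j<m. y j ^ m) powr (1 / m) \<le> (\<Sum>j<m. y j ^ m / m)"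
    using arith_geom_mean[of "{..<m}" "\<lambda>j. y j ^ m"] assms by force
  ultimately show ?thesis by (simp add: sum_divide_distrib)
qed

text \<open>The integrand of the Gaussian integral is a product of cosines of l Re (g z^k). It is cut into m
  blocks of r consecutive factors, superfluous factors being bounded by one. By AM-GM it is at most the
  mean of the m-th powers of the blocks; as m is even the sign of a block does not matter. The m-th power
  of the block starting at z^(jr) is again the integrand of a walk, in which each of the steps
  z^(jr), ..., z^(jr+r-1) occurs m times. A rotation removes z^(jr), so all m means agree.\<close>

lemma block_comparison:
  assumes "even m" "0 < m" "r * m \<le> n" and z: "cmod z = 1"
  shows "sign_mean n (\<lambda>x. exp (- (l * cmod (walk n x z))\<^sup>2 / 2))
     \<le> sign_mean (r * m) (\<lambda>x. exp (- (l * cmod (\<Sum>k<r * m. of_real (x k) * z ^ (k div m)))\<^sup>2 / 2))"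
    (is "_ \<le> ?R")
proof -
  note measurable_gauss_component [measurable]
  interpret prob_space "gauss 2" by (rule prob_space_gauss)
  define f :: "nat \<Rightarrow> (nat \<Rightarrow> real) \<Rightarrow> real"
    where "f k g = cos (l * (g 0 * Re (z ^ k) + g 1 * Im (z ^ k)))" for k g
  have f_le: "\<bar>f k g\<bar> \<le> 1" for k g by (simp add: f_def)
  have [measurable]: "f k \<in> borel_measurable (gauss 2)" for k
    unfolding f_def by measurable
  have prod_le: "\<bar>\<Prod>k\<in>K. f (p k) g\<bar> \<le> 1" for K :: "nat set" and p g
    unfolding abs_prod by (rule prod_le_1) (use f_le in auto)
  have block: "(\<integral>g. (\<Prod>i<r. f (j * r + i) g) ^ m \<partial>gauss 2) = ?R" for j
  proof -
    define w where "w = z ^ (j * r)"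
    have w: "cmod w = 1" by (simp add: w_def norm_power z)
    have "(\<Prod>i<r. f (j * r + i) g) ^ m = (\<Prod>k<r * m. f (j * r + k div m) g)" for g
    proof -
      have "(\<Prod>k<r * m. f (j * r + k div m) g)
          = (\<Prod>i<r. \<Prod>k\<in>{i * m..<i * m + m}. f (j * r + k div m) g)"
        by (rule prod.nat_group[symmetric])
      also have "\<dots> = (\<Prod>i<r. \<Prod>k\<in>{i * m..<i * m + m}. f (j * r + i) g)"
      proof (intro prod.cong refl)
        fix i k assume "k \<in> {i * m..<i * m + m}"
        then have "k div m = i" by (intro div_nat_eqI) (auto simp: mult.commute)
        then show "f (j * r + k div m) g = f (j * r + i) g" by simp
      qed
      finally show ?thesis by (simp add: prod_power_distrib)
    qed
    then have "(\<integral>g. (\<Prod>i<r. f (j * r + i) g) ^ m \<partial>gauss 2)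
        = sign_mean (r * m) (\<lambda>x. exp (- (l * cmod (\<Sum>k<r * m. of_real (x k) * (w * z ^ (k div m))))\<^sup>2 / 2))"
      unfolding sign_mean_exp_cmod by (simp add: f_def w_def power_add)
    also have "\<dots> = ?R"
    proof (rule sign_mean_cong)
      fix x :: "nat \<Rightarrow> real"
      have "(\<Sum>k<r * m. of_real (x k) * (w * z ^ (k div m))) = w * (\<Sum>k<r * m. of_real (x k) * z ^ (k div m))"
        by (simp add: sum_distrib_left mult_ac)
      then show "exp (- (l * cmod (\<Sum>k<r * m. of_real (x k) * (w * z ^ (k div m))))\<^sup>2 / 2)
          = exp (- (l * cmod (\<Sum>k<r * m. of_real (x k) * z ^ (k div m)))\<^sup>2 / 2)"
        by (simp add: norm_mult w)
    qed
    finally show ?thesis .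
  qed
  have int: "integrable (gauss 2) (\<lambda>g. (\<Prod>i<r. f (j * r + i) g) ^ m)" for j
    by (intro integrable_const_bound[where B = 1] AE_I2)
       (auto simp: power_abs intro!: power_le_one prod_le)
  have le: "(\<Prod>k<n. f k g) \<le> (\<Sum>j<m. (\<Prod>i<r. f (j * r + i) g) ^ m) / m" for g
  proof -
    have "(\<Prod>k<n. f k g) \<le> \<bar>\<Prod>k<n. f k g\<bar>" by simp
    also have "\<dots> = (\<Prod>k<m * r. \<bar>f k g\<bar>) * (\<Prod>k\<in>{m * r..<n}. \<bar>f k g\<bar>)"
      unfolding abs_prod
      by (subst prod.union_disjoint[symmetric])
         (use \<open>r * m \<le> n\<close> in \<open>auto simp: mult.commute intro!: prod.cong\<close>)
    also have "\<dots> \<le> (\<Prod>k<m * r. \<bar>f k g\<bar>) * 1"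
      using prod_le[of "\<lambda>k. k" g "{m * r..<n}"] by (intro mult_left_mono prod_nonneg) (auto simp: abs_prod)
    also have "\<dots> = (\<Prod>j<m. \<bar>\<Prod>i<r. f (j * r + i) g\<bar>)"
    proof -
      have "(\<Prod>k\<in>{j * r..<j * r + r}. \<bar>f k g\<bar>) = (\<Prod>i<r. \<bar>f (j * r + i) g\<bar>)" for j
        using prod.shift_bounds_nat_ivl[of "\<lambda>k. \<bar>f k g\<bar>" 0 "j * r" r]
        by (simp add: add.commute atLeast0LessThan)
      then show ?thesis unfolding prod.nat_group[symmetric] abs_prod by simp
    qed
    also have "\<dots> \<le> (\<Sum>j<m. \<bar>\<Prod>i<r. f (j * r + i) g\<bar> ^ m) / m"
      by (rule prod_le_mean_power) (use \<open>0 < m\<close> in auto)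
    finally show ?thesis
      using \<open>even m\<close> by (simp add: power_even_abs)
  qed
  have "sign_mean n (\<lambda>x. exp (- (l * cmod (walk n x z))\<^sup>2 / 2)) = (\<integral>g. (\<Prod>k<n. f k g) \<partial>gauss 2)"
    unfolding walk_def sign_mean_exp_cmod f_def ..
  also have "\<dots> \<le> (\<integral>g. (\<Sum>j<m. (\<Prod>i<r. f (j * r + i) g) ^ m) / m \<partial>gauss 2)"
  proof (rule integral_mono)
    show "integrable (gauss 2) (\<lambda>g. \<Prod>k<n. f k g)"
      by (intro integrable_const_bound[where B = 1]) (auto intro!: prod_le[unfolded abs_prod] simp: abs_prod)
  qed (use int le in auto)
  also have "\<dots> = (\<Sum>j<m. ?R) / m"
    using int by (simp add: block)
  also have "\<dots> = ?R" using \<open>0 < m\<close> by simp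
  finally show ?thesis .
qed

lemma sum_symmetric_geometric_le:
  assumes "0 < q" "q < (1::real)"
  shows "(\<Sum>j\<le>2 * h. q powr \<bar>real j - real h\<bar>) \<le> 2 / (1 - q)"
proof -
  have geo: "(\<Sum>i\<le>h. q ^ i) \<le> 1 / (1 - q)"
    using assms sum_gp_basic[of q h] by (simp add: field_simps sum_gp0)
  let ?f = "\<lambda>j::nat. q powr \<bar>real j - real h\<bar>"
  have "{..2 * h} = (\<lambda>i. h - i) ` {..h} \<union> (\<lambda>i. h + i) ` {..h}"
  proof (intro set_eqI iffI)
    fix j assume "j \<in> {..2 * h}"
    then show "j \<in> (\<lambda>i. h - i) ` {..h} \<union> (\<lambda>i. h + i) ` {..h}"
      by (cases "j \<le> h") (auto simp: image_iff intro: bexI[of _ "h - j"] bexI[of _ "j - h"])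
  qed auto
  then have "(\<Sum>j\<le>2 * h. ?f j) \<le> (\<Sum>j\<in>(\<lambda>i. h - i) ` {..h}. ?f j) + (\<Sum>j\<in>(\<lambda>i. h + i) ` {..h}. ?f j)"
    using sum.union_inter[of "(\<lambda>i. h - i) ` {..h}" "(\<lambda>i. h + i) ` {..h}" ?f]
      sum_nonneg[of "(\<lambda>i. h - i) ` {..h} \<inter> (\<lambda>i. h + i) ` {..h}" ?f]
    by simp
  also have "(\<Sum>j\<in>(\<lambda>i. h - i) ` {..h}. ?f j) = (\<Sum>i\<le>h. q ^ i)"
    by (subst sum.reindex) (use assms in \<open>auto simp: inj_on_def powr_realpow of_nat_diff intro!: sum.cong\<close>)
  also have "(\<Sum>j\<in>(\<lambda>i. h + i) ` {..h}. ?f j) = (\<Sum>i\<le>h. q ^ i)"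
    by (subst sum.reindex) (use assms in \<open>auto simp: inj_on_def powr_realpow intro!: sum.cong\<close>)
  finally show ?thesis using geo by simp
qed

lemma exp_half_le_2: "exp (1 / 2 :: real) \<le> 2"
proof -
  have "exp (1 / 2 :: real) ^ 2 = exp 1" by (simp add: exp_of_nat_mult[symmetric])
  also have "\<dots> \<le> 2 ^ 2" using exp_le by simp
  finally show ?thesis by (rule power2_le_imp_le) simp
qed

lemma indicator_le_exp:
  fixes u :: real
  shows "(if u\<^sup>2 \<le> 1 then 1 else 0) \<le> 2 * exp (- u\<^sup>2 / 2)"
proof (cases "u\<^sup>2 \<le> 1")
  case True
  then have "exp (- (1 / 2)) \<le> exp (- u\<^sup>2 / 2)" by simp
  moreover have "1 / 2 \<le> exp (- (1 / 2) :: real)"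
    using exp_half_le_2 by (simp add: exp_minus field_simps)
  ultimately have "1 \<le> 2 * exp (- u\<^sup>2 / 2)" by linarith
  then show ?thesis using True by (simp only: if_True)
qed simp

text \<open>The sum of 2h signs hits each value with probability at most 1 / sqrt (2h+1), and the Gaussian
  weight exp (- 2 u^2) is dominated by the geometric weight exp (1/2 - 2 u).\<close>

lemma sign_mean_exp_sum_le:
  assumes "0 < l"
  shows "sign_mean (2 * h) (\<lambda>x. exp (- (l * (\<Sum>k<2 * h. x k))\<^sup>2 / 2)) \<le> (4 + 2 / l) / sqrt (2 * real h + 1)"
proof -
  define q where "q = exp (- 2 * l)"
  have q: "0 < q" "q < 1" using assms by (auto simp: q_def)
  have "sign_mean (2 * h) (\<lambda>x. exp (- (l * (\<Sum>k<2 * h. x k))\<^sup>2 / 2))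
      = (\<Sum>j\<le>2 * h. real (2 * h choose j) / 2 ^ (2 * h) * exp (- (l * (2 * real j - real (2 * h)))\<^sup>2 / 2))"
    by (rule sign_mean_of_sum)
  also have "\<dots> \<le> (\<Sum>j\<le>2 * h. 1 / sqrt (2 * real h + 1) * (2 * q powr \<bar>real j - real h\<bar>))"
  proof (intro sum_mono mult_mono)
    fix j
    have "real (2 * h choose j) / 2 ^ (2 * h) \<le> real (2 * h choose h) / 2 ^ (2 * h)"
      by (intro divide_right_mono) (simp_all add: binomial_maximum')
    then show "real (2 * h choose j) / 2 ^ (2 * h) \<le> 1 / sqrt (2 * real h + 1)"
      using central_binomial_upper_bound[of h] by linarith
    define u where "u = l * \<bar>real j - real h\<bar>"
    have "- (l * (2 * real j - real (2 * h)))\<^sup>2 / 2 = - 2 * u\<^sup>2"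
    proof -
      have "2 * real j - real (2 * h) = 2 * (real j - real h)" by simp
      then have "(l * (2 * real j - real (2 * h)))\<^sup>2 = (2 * (l * (real j - real h)))\<^sup>2"
        by (simp only: mult_ac)
      then show ?thesis by (simp add: u_def power_mult_distrib)
    qed
    also have "\<dots> \<le> 1 / 2 + - 2 * u"
      using zero_le_power2[of "2 * u - 1"] by (simp add: power2_eq_square algebra_simps)
    finally have "exp (- (l * (2 * real j - real (2 * h)))\<^sup>2 / 2) \<le> exp (1 / 2) * exp (- 2 * u)"
      by (simp add: exp_add[symmetric])
    also have "\<dots> \<le> 2 * exp (- 2 * u)"
      by (intro mult_right_mono exp_half_le_2) auto
    also have "exp (- 2 * u) = q powr \<bar>real j - real h\<bar>"
      by (simp add: q_def u_def powr_def)
    finally show "exp (- (l * (2 * real j - real (2 * h)))\<^sup>2 / 2) \<le> 2 * q powr \<bar>real j - real h\<bar>" .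
  qed auto
  also have "\<dots> = 2 / sqrt (2 * real h + 1) * (\<Sum>j\<le>2 * h. q powr \<bar>real j - real h\<bar>)"
    by (simp add: sum_distrib_left)
  also have "\<dots> \<le> 2 / sqrt (2 * real h + 1) * (2 / (1 - q))"
    by (intro mult_left_mono sum_symmetric_geometric_le q) auto
  also have "2 / (1 - q) \<le> 2 * (1 + 1 / (2 * l))"
  proof -
    have "1 + 2 * l \<le> exp (2 * l)" by (rule exp_ge_add_one_self)
    then have "q \<le> 1 / (1 + 2 * l)"
      using assms by (simp add: q_def exp_minus field_simps)
    then have "2 * l / (1 + 2 * l) \<le> 1 - q" using assms by (simp add: field_simps)
    then have "1 / (1 - q) \<le> 1 / (2 * l / (1 + 2 * l))"
      using assms by (intro divide_left_mono) (use q in auto)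
    also have "1 / (2 * l / (1 + 2 * l)) = 1 + 1 / (2 * l)"
      using assms by (simp add: field_simps)
    finally show ?thesis by simp
  qed
  finally show ?thesis
    using assms by (simp add: field_simps mult_left_mono)
qed

text \<open>The case r = 1 of the comparison, in which every step is replaced by the real number 1. It is
  uniform in z, and therefore covers the points near 1 and -1 where S is not close to a complex
  Gaussian.\<close>

lemma small_ball_pointwise:
  assumes "2 \<le> n" "cmod z = 1" "0 < e"
  shows "sign_mean n (\<lambda>x. if (cmod (walk n x z))\<^sup>2 / n \<le> e then 1 else 0) \<le> 8 / sqrt n + 4 * sqrt e"
proof -
  define h where "h = n div 2"
  have h: "0 < h" "2 * h \<le> n" "n \<le> 2 * h + 1" using assms(1) by (auto simp: h_def)
  define l where "l = 1 / sqrt (e * n)"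
  have l: "0 < l" using assms by (simp add: l_def)
  have "sign_mean n (\<lambda>x. if (cmod (walk n x z))\<^sup>2 / n \<le> e then 1 else 0)
      \<le> sign_mean n (\<lambda>x. 2 * exp (- (l * cmod (walk n x z))\<^sup>2 / 2))"
  proof (rule sign_mean_mono)
    fix x
    have "(l * cmod (walk n x z))\<^sup>2 = (cmod (walk n x z))\<^sup>2 / n / e"
      using assms by (simp add: l_def power_mult_distrib power_divide field_simps)
    then have "(cmod (walk n x z))\<^sup>2 / n \<le> e \<longleftrightarrow> (l * cmod (walk n x z))\<^sup>2 \<le> 1"
      using assms by (simp only: pos_divide_le_eq mult_1)
    then show "(if (cmod (walk n x z))\<^sup>2 / n \<le> e then 1 else 0) \<le> 2 * exp (- (l * cmod (walk n x z))\<^sup>2 / 2)"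
      using indicator_le_exp[of "l * cmod (walk n x z)"] by (simp only:)
  qed
  also have "\<dots> = 2 * sign_mean n (\<lambda>x. exp (- (l * cmod (walk n x z))\<^sup>2 / 2))"
    by (rule sign_mean_cmult)
  also have "sign_mean n (\<lambda>x. exp (- (l * cmod (walk n x z))\<^sup>2 / 2))
      \<le> sign_mean (1 * (2 * h)) (\<lambda>x. exp (- (l * cmod (\<Sum>k<1 * (2 * h). of_real (x k) * z ^ (k div (2 * h))))\<^sup>2 / 2))"
    by (rule block_comparison) (use h assms in auto)
  also have "\<dots> = sign_mean (2 * h) (\<lambda>x. exp (- (l * (\<Sum>k<2 * h. x k))\<^sup>2 / 2))"
    by (simp add: of_real_sum[symmetric] power_mult_distrib del: of_real_sum)
  also have "\<dots> \<le> (4 + 2 / l) / sqrt (2 * real h + 1)"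
    by (rule sign_mean_exp_sum_le[OF l])
  also have "\<dots> \<le> (4 + 2 / l) / sqrt n"
    using h l assms by (intro divide_left_mono) auto
  also have "2 * ((4 + 2 / l) / sqrt n) = 8 / sqrt n + 4 * sqrt e"
    using assms by (simp add: l_def real_sqrt_mult field_simps)
  finally show ?thesis by simp
qed

section \<open>Singular integrals over the circle\<close>

definition circ :: "real measure" where
  "circ = uniform_measure lborel {-pi..pi}"

lemma sets_circ [measurable_cong, simp]: "sets circ = sets borel"
  by (simp add: circ_def)

lemma space_circ [simp]: "space circ = UNIV"
  by (simp add: circ_def)

lemma prob_space_circ: "prob_space circ"
  unfolding circ_def by (rule prob_space_uniform_measure) auto

interpretation circ: prob_space circ
  by (rule prob_space_circ)

lemma measure_circ_UNIV [simp]: "measure circ UNIV = 1"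
  using circ.prob_space by simp

lemma measurable_cis [measurable]: "cis \<in> borel_measurable borel"
  unfolding cis_conv_exp by measurable

lemma nn_integral_circ:
  assumes [measurable]: "f \<in> borel_measurable borel"
  shows "(\<integral>\<^sup>+t. f t \<partial>circ) = (\<integral>\<^sup>+t. f t * indicator {-pi..pi} t \<partial>lborel) / ennreal (2 * pi)"
  unfolding circ_def by (subst nn_integral_uniform_measure) auto

lemma integral_circ:
  fixes f :: "real \<Rightarrow> real"
  assumes [measurable]: "f \<in> borel_measurable borel"
  shows "(\<integral>t. f t \<partial>circ) = (LBINT t:{-pi..pi}. f t) / (2 * pi)"
proof -
  have circ_eq: "circ = density lborel (\<lambda>t. ennreal (indicator {-pi..pi} t / (2 * pi)))"
    unfolding circ_def uniform_measure_def
    by (intro density_cong) (auto simp: indicator_def divide_ennreal[symmetric] ennreal_1[symmetric] simp del: ennreal_1)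
  have "(\<integral>t. f t \<partial>circ) = (\<integral>t. (indicator {-pi..pi} t / (2 * pi)) * f t \<partial>lborel)"
    unfolding circ_eq by (rule integral_real_density) auto
  then show ?thesis by (simp add: set_lebesgue_integral_def)
qed

lemma AE_circ_cis_neq: "AE t in circ. cis t \<noteq> \<alpha>"
proof -
  have "AE t in lborel. t \<in> {-pi..pi} \<longrightarrow> cis t \<noteq> \<alpha>"
  proof (rule AE_I')
    let ?N = "{arccos (Re \<alpha>), - arccos (Re \<alpha>)}"
    show "?N \<in> null_sets lborel" by (intro finite_imp_null_set_lborel) auto
    have "t \<in> ?N" if "t \<in> {-pi..pi}" "cis t = \<alpha>" for t
    proof -
      have "cos \<bar>t\<bar> = Re \<alpha>" using that by auto
      then have "arccos (Re \<alpha>) = \<bar>t\<bar>" using that by (metis abs_ge_zero abs_le_iff arccos_cos atLeastAtMost_iff minus_le_iff)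
      then show ?thesis by (auto simp: abs_if split: if_splits)
    qed
    then show "{t \<in> space lborel. \<not> (t \<in> {-pi..pi} \<longrightarrow> cis t \<noteq> \<alpha>)} \<subseteq> ?N" by blast
  qed
  then show ?thesis
    unfolding circ_def by (intro AE_uniform_measureI) auto
qed

lemma abs_sin_ge_half:
  fixes x :: real
  assumes "\<bar>x\<bar> \<le> pi / 2"
  shows "\<bar>x\<bar> / 2 \<le> \<bar>sin x\<bar>"
proof -
  define y where "y = \<bar>x\<bar> / 2"
  have y: "0 \<le> y" "y \<le> pi / 4" using assms by (auto simp: y_def)
  have "sin 0 - 0 * cos 0 \<le> sin y - y * cos y"
  proof (rule DERIV_nonneg_imp_nondecreasing[OF y(1)])
    fix u assume u: "0 \<le> u" "u \<le> y"
    have "((\<lambda>u. sin u - u * cos u) has_real_derivative u * sin u) (at u)"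
      by (auto intro!: derivative_eq_intros)
    moreover have "0 \<le> u * sin u" using u y by (intro mult_nonneg_nonneg sin_ge_zero) auto
    ultimately show "\<exists>d. ((\<lambda>u. sin u - u * cos u) has_real_derivative d) (at u) \<and> 0 \<le> d" by blast
  qed
  then have siny: "y * cos y \<le> sin y" by simp
  have "cos (pi / 4) \<le> cos y" using y by (intro cos_monotone_0_pi_le) auto
  then have c: "sqrt 2 / 2 \<le> cos y" by (simp add: cos_45)
  then have c0: "0 \<le> cos y" by (rule order_trans[rotated]) simp
  have "1 / 2 = (sqrt 2 / 2) * (sqrt 2 / 2)" by simp
  also have "\<dots> \<le> cos y * cos y" by (intro mult_mono c c0) auto
  finally have "y * (1 / 2) \<le> y * (cos y * cos y)" using y by (intro mult_left_mono)
  also have "\<dots> \<le> sin y * cos y" using mult_right_mono[OF siny c0] by (simp add: mult_ac)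
  finally have "y \<le> sin (2 * y)" by (simp add: sin_double)
  also have "2 * y = \<bar>x\<bar>" by (simp add: y_def)
  finally show ?thesis by (auto simp: y_def abs_if split: if_splits)
qed

lemma cmod_cis_diff: "cmod (cis t - cis s) = 2 * \<bar>sin ((t - s) / 2)\<bar>"
proof -
  have "cis t - cis s = cis s * (exp (\<i> * of_real (t - s)) - 1)"
    by (simp add: cis_conv_exp exp_diff right_diff_distrib)
  then show ?thesis by (simp add: norm_mult dist_exp_i_1 del: of_real_diff)
qed

text \<open>The point of the circle with argument Arg \<open>\<alpha>\<close> is at least as close to \<open>\<alpha>\<close> as cis t is, so
  its distance to cis t is at most twice the distance of \<open>\<alpha>\<close> to cis t. The two translates of the
  argument account for the periodicity of the circle.\<close>

lemma cmod_cis_diff_ge: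
  assumes "t \<in> {-pi..pi}"
  shows "\<exists>c\<in>{Arg \<alpha>, Arg \<alpha> + 2 * pi, Arg \<alpha> - 2 * pi}. \<bar>t - c\<bar> / 4 \<le> cmod (cis t - \<alpha>)"
proof -
  define s where "s = Arg \<alpha>"
  have s: "-pi \<le> s" "s \<le> pi" using Arg_bounded[of \<alpha>] by (auto simp: s_def)
  have "\<alpha> = cmod \<alpha> * cis s"
    by (metis rcis_cmod_Arg rcis_def s_def)
  then have "cmod (\<alpha> - cis s) = \<bar>cmod \<alpha> - 1\<bar>"
    by (metis mult_1 left_diff_distrib norm_mult norm_cis mult.right_neutral norm_of_real of_real_1 of_real_diff)
  also have "\<dots> \<le> cmod (cis t - \<alpha>)"
    using norm_triangle_ineq3[of "\<alpha>" "cis t"] by (simp add: norm_minus_commute)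
  finally have "cmod (cis t - cis s) \<le> 2 * cmod (cis t - \<alpha>)"
    using norm_triangle_ineq[of "cis t - \<alpha>" "\<alpha> - cis s"] by simp
  then have main: "\<bar>sin ((t - s) / 2)\<bar> \<le> cmod (cis t - \<alpha>)" by (simp add: cmod_cis_diff)
  have *: "\<bar>u\<bar> / 4 \<le> \<bar>sin (u / 2)\<bar>" if "\<bar>u\<bar> \<le> pi" for u :: real
    using abs_sin_ge_half[of "u / 2"] that by simp
  consider "\<bar>t - s\<bar> \<le> pi" | "\<bar>t - (s + 2 * pi)\<bar> \<le> pi" | "\<bar>t - (s - 2 * pi)\<bar> \<le> pi"
    using assms s by (auto simp: abs_le_iff) linarith
  then show ?thesis
  proof cases
    case 1
    then show ?thesis using *[OF 1] main by (auto simp: s_def)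
  next
    case 2
    have "sin ((t - (s + 2 * pi)) / 2) = - sin ((t - s) / 2)"
      using sin_minus_pi[of "(t - s) / 2"] by (simp add: diff_divide_distrib add_divide_distrib algebra_simps)
    then have "\<bar>t - (s + 2 * pi)\<bar> / 4 \<le> cmod (cis t - \<alpha>)" using *[OF 2] main by simp
    then show ?thesis by (auto simp: s_def)
  next
    case 3
    have "sin ((t - (s - 2 * pi)) / 2) = - sin ((t - s) / 2)"
      using sin_periodic_pi[of "(t - s) / 2"] by (simp add: diff_divide_distrib add_divide_distrib algebra_simps)
    then have "\<bar>t - (s - 2 * pi)\<bar> / 4 \<le> cmod (cis t - \<alpha>)" using *[OF 3] main by simp
    then show ?thesis by (auto simp: s_def)
  qed
qed

lemma nn_integral_inverse_sqrt_le:
  "(\<integral>\<^sup>+t. ennreal (\<bar>t - c\<bar> powr (-1/2)) * indicator {-pi..pi} t \<partial>lborel) \<le> ennreal (2 * pi + 4)"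
proof -
  have half: "(\<integral>\<^sup>+t. ennreal (t powr (-1/2)) * indicator {0..1} t \<partial>lborel) = ennreal 2"
  proof (rule nn_integral_has_integral_lebesgue')
    show "((\<lambda>t::real. t powr (-1/2)) has_integral 2) {0..1}"
      using has_integral_powr_from_0[of "-1/2" 1] by simp
  qed auto
  have "(\<integral>\<^sup>+t. ennreal (\<bar>t - c\<bar> powr (-1/2)) * indicator {-pi..pi} t \<partial>lborel)
      \<le> (\<integral>\<^sup>+t. indicator {-pi..pi} t + (ennreal ((t - c) powr (-1/2)) * indicator {0..1} (t - c)
           + ennreal ((c - t) powr (-1/2)) * indicator {0..1} (c - t)) \<partial>lborel)"
  proof (rule nn_integral_mono)
    fix t :: real
    consider "1 \<le> \<bar>t - c\<bar>" | "0 \<le> t - c" "t - c \<le> 1" | "0 \<le> c - t" "c - t \<le> 1" by linarith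
    then show "ennreal (\<bar>t - c\<bar> powr (-1/2)) * indicator {-pi..pi} t
        \<le> indicator {-pi..pi} t + (ennreal ((t - c) powr (-1/2)) * indicator {0..1} (t - c)
           + ennreal ((c - t) powr (-1/2)) * indicator {0..1} (c - t))"
    proof cases
      case 1
      then have "\<bar>t - c\<bar> powr (-1/2) \<le> 1 powr (-1/2)" by (intro powr_mono2') auto
      then have "ennreal (\<bar>t - c\<bar> powr (-1/2)) * indicator {-pi..pi} t \<le> indicator {-pi..pi} t"
        using ennreal_leI[of "\<bar>t - c\<bar> powr (-1/2)" 1] by (auto simp: indicator_def)
      then show ?thesis by (rule order_trans) simp
    qed (auto simp: indicator_def abs_if intro: add_increasing add_increasing2)
  qed
  also have "\<dots> = ennreal (2 * pi) + ((\<integral>\<^sup>+t. ennreal ((t - c) powr (-1/2)) * indicator {0..1} (t - c) \<partial>lborel)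
           + (\<integral>\<^sup>+t. ennreal ((c - t) powr (-1/2)) * indicator {0..1} (c - t) \<partial>lborel))"
    by (simp add: nn_integral_add)
  also have "(\<integral>\<^sup>+t. ennreal ((t - c) powr (-1/2)) * indicator {0..1} (t - c) \<partial>lborel) = ennreal 2"
    using nn_integral_real_affine[of "\<lambda>t. ennreal (t powr (-1/2)) * indicator {0..1} t" 1 "- c"] half by simp
  also have "(\<integral>\<^sup>+t. ennreal ((c - t) powr (-1/2)) * indicator {0..1} (c - t) \<partial>lborel) = ennreal 2"
    using nn_integral_real_affine[of "\<lambda>t. ennreal (t powr (-1/2)) * indicator {0..1} t" "-1" "c"] half by simp
  also have "ennreal (2 * pi) + (ennreal 2 + ennreal 2) = ennreal (2 * pi + 4)"
    by (simp add: ennreal_plus[symmetric] ennreal_numeral[symmetric] del: ennreal_plus ennreal_numeral)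
  finally show ?thesis .
qed

text \<open>What matters is that the bound is uniform in \<open>\<alpha>\<close>: it is applied to the unknown roots of
  random polynomials.\<close>

lemma nn_integral_circ_inverse_sqrt_le:
  "(\<integral>\<^sup>+t. ennreal (cmod (cis t - \<alpha>) powr (-1/2)) \<partial>circ) \<le> ennreal 10"
proof -
  let ?S = "{Arg \<alpha>, Arg \<alpha> + 2 * pi, Arg \<alpha> - 2 * pi}"
  have "(\<integral>\<^sup>+t. ennreal (cmod (cis t - \<alpha>) powr (-1/2)) * indicator {-pi..pi} t \<partial>lborel)
      \<le> (\<integral>\<^sup>+t. (\<Sum>c\<in>?S. 2 * (ennreal (\<bar>t - c\<bar> powr (-1/2)) * indicator {-pi..pi} t)) \<partial>lborel)"
  proof (rule nn_integral_mono_AE)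
    have "AE t in lborel. t \<notin> ?S"
      by (intro AE_not_in finite_imp_null_set_lborel) auto
    then show "AE t in lborel. ennreal (cmod (cis t - \<alpha>) powr (-1/2)) * indicator {-pi..pi} t
        \<le> (\<Sum>c\<in>?S. 2 * (ennreal (\<bar>t - c\<bar> powr (-1/2)) * indicator {-pi..pi} t))"
    proof eventually_elim
      case (elim t)
      show ?case
      proof (cases "t \<in> {-pi..pi}")
        case True
        then obtain c where c: "c \<in> ?S" "\<bar>t - c\<bar> / 4 \<le> cmod (cis t - \<alpha>)"
          using cmod_cis_diff_ge by blast
        have "t \<noteq> c" using elim c by auto
        then have "cmod (cis t - \<alpha>) powr (-1/2) \<le> (\<bar>t - c\<bar> / 4) powr (-1/2)"
          using c by (intro powr_mono2') auto
        also have "\<dots> = 2 * \<bar>t - c\<bar> powr (-1/2)"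
        proof -
          have "(4::real) powr (1/2) = 2" by (simp add: powr_half_sqrt)
          then show ?thesis by (simp add: powr_divide powr_minus field_simps)
        qed
        finally have "ennreal (cmod (cis t - \<alpha>) powr (-1/2)) * indicator {-pi..pi} t
            \<le> 2 * (ennreal (\<bar>t - c\<bar> powr (-1/2)) * indicator {-pi..pi} t)"
          using True by (simp add: ennreal_mult'[symmetric] ennreal_numeral[symmetric] ennreal_leI
              del: ennreal_numeral)
        also have "\<dots> \<le> (\<Sum>c\<in>?S. 2 * (ennreal (\<bar>t - c\<bar> powr (-1/2)) * indicator {-pi..pi} t))"
          by (intro member_le_sum c) auto
        finally show ?thesis .
      qed simp
    qed
  qed
  also have "\<dots> = (\<Sum>c\<in>?S. 2 * (\<integral>\<^sup>+t. ennreal (\<bar>t - c\<bar> powr (-1/2)) * indicator {-pi..pi} t \<partial>lborel))"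
    by (subst nn_integral_sum) (auto simp: nn_integral_cmult intro!: sum.cong)
  also have "\<dots> \<le> (\<Sum>c\<in>?S. 2 * ennreal (2 * pi + 4))"
    by (intro sum_mono mult_left_mono nn_integral_inverse_sqrt_le) auto
  also have "\<dots> \<le> of_nat 3 * (2 * ennreal (2 * pi + 4))"
    by (rule sum_bounded_above[THEN order_trans])
       (auto intro!: mult_right_mono simp: card_insert_if)
  also have "\<dots> = ennreal (12 * pi + 24)"
    by (simp add: ennreal_mult'[symmetric] ennreal_numeral[symmetric] distrib_left
        del: ennreal_numeral ennreal_plus)
  finally have "(\<integral>\<^sup>+t. ennreal (cmod (cis t - \<alpha>) powr (-1/2)) \<partial>circ) \<le> ennreal (12 * pi + 24) / ennreal (2 * pi)"
    by (subst nn_integral_circ) (auto intro: divide_right_mono_ennreal)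
  also have "\<dots> = ennreal ((12 * pi + 24) / (2 * pi))"
    by (rule divide_ennreal) auto
  also have "\<dots> \<le> ennreal 10"
    using pi_gt3 by (intro ennreal_leI) (simp add: field_simps)
  finally show ?thesis .
qed

lemma integrable_circ_inverse_sqrt: "integrable circ (\<lambda>t. cmod (cis t - \<alpha>) powr (-1/2))"
proof (rule integrableI_bounded)
  show "(\<integral>\<^sup>+t. ennreal (norm (cmod (cis t - \<alpha>) powr (-1/2))) \<partial>circ) < \<infinity>"
    using nn_integral_circ_inverse_sqrt_le[of \<alpha>] by (auto intro: le_less_trans)
qed measurable

lemma integral_circ_inverse_sqrt_le: "(\<integral>t. cmod (cis t - \<alpha>) powr (-1/2) \<partial>circ) \<le> 10"
  by (rule integral_real_bounded) (use nn_integral_circ_inverse_sqrt_le in auto)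

lemma exp_neg_square_le_powr:
  fixes u :: real
  assumes "0 < u"
  shows "exp (- u\<^sup>2 / 2) \<le> u powr (-1/4)"
proof (cases "u \<le> 1")
  case True
  have "exp (- u\<^sup>2 / 2) \<le> 1" by simp
  also have "1 \<le> u powr (-1/4)" using True assms powr_mono2'[of "-1/4" u 1] by simp
  finally show ?thesis .
next
  case False
  have "u \<le> 1 + u\<^sup>2 / 2" using zero_le_power2[of "u - 1"] by (simp add: power2_eq_square algebra_simps)
  also have "\<dots> \<le> exp (u\<^sup>2 / 2)" by (rule exp_ge_add_one_self)
  finally have "exp (- u\<^sup>2 / 2) \<le> 1 / u" using assms by (simp add: exp_minus field_simps)
  also have "\<dots> = u powr (-1)" using assms by (simp add: powr_minus divide_inverse)
  also have "\<dots> \<le> u powr (-1/4)" using False by (intro powr_mono) auto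
  finally show ?thesis .
qed

text \<open>The Gaussian is replaced by the power - 1/4, so that after factoring the quadratic the
  inequality between the means leaves powers - 1/2 of the distances to single roots.\<close>

lemma integral_circ_exp_quadratic_le:
  fixes a b c :: complex
  assumes "1 \<le> cmod c" "0 < l"
  shows "(\<integral>t. exp (- (l * cmod (a + b * cis t + c * (cis t)\<^sup>2))\<^sup>2 / 2) \<partial>circ) \<le> 10 * l powr (-1/4)"
proof -
  have c0: "c \<noteq> 0" using assms by auto
  define p where "p = [:a, b, c:]"
  have deg: "degree p = 2" "lead_coeff p = c" "p \<noteq> 0" using c0 by (auto simp: p_def)
  then obtain A where A: "size A = 2" "p = smult c (\<Prod>x\<in>#A. [:-x, 1:])"
    using alg_closed_imp_factorization[OF deg(3)] unfolding deg by blast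
  obtain \<alpha> B where "A = add_mset \<alpha> B"
    using size_eq_Suc_imp_eq_union[of A 1] A(1) by auto
  moreover from this A(1) obtain \<beta> where "B = {#\<beta>#}"
    using size_1_singleton_mset[of B] by auto
  ultimately have "A = {#\<alpha>, \<beta>#}" by simp
  then have fact: "a + b * z + c * z\<^sup>2 = c * (z - \<alpha>) * (z - \<beta>)" for z
    using arg_cong[OF A(2), of "\<lambda>p. poly p z"] by (simp add: p_def algebra_simps power2_eq_square)
  have "(\<integral>t. exp (- (l * cmod (a + b * cis t + c * (cis t)\<^sup>2))\<^sup>2 / 2) \<partial>circ)
     \<le> (\<integral>t. l powr (-1/4) / 2 * (cmod (cis t - \<alpha>) powr (-1/2) + cmod (cis t - \<beta>) powr (-1/2)) \<partial>circ)"
  proof (rule integral_mono_AE)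
    show "AE t in circ. exp (- (l * cmod (a + b * cis t + c * (cis t)\<^sup>2))\<^sup>2 / 2)
       \<le> l powr (-1/4) / 2 * (cmod (cis t - \<alpha>) powr (-1/2) + cmod (cis t - \<beta>) powr (-1/2))"
      using AE_circ_cis_neq[of \<alpha>] AE_circ_cis_neq[of \<beta>]
    proof eventually_elim
      case (elim t)
      define u v where "u = cmod (cis t - \<alpha>)" and "v = cmod (cis t - \<beta>)"
      have uv: "0 < u" "0 < v" using elim by (auto simp: u_def v_def)
      have eq: "cmod (a + b * cis t + c * (cis t)\<^sup>2) = cmod c * (u * v)"
        by (simp add: fact norm_mult u_def v_def)
      have "exp (- (l * (cmod c * (u * v)))\<^sup>2 / 2) \<le> (l * (cmod c * (u * v))) powr (-1/4)"
        using assms uv c0 by (intro exp_neg_square_le_powr) auto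
      also have "\<dots> \<le> (l * (u * v)) powr (-1/4)"
        using assms uv c0 by (intro powr_mono2') auto
      also have "\<dots> = l powr (-1/4) * (u powr (-1/4) * v powr (-1/4))"
        using assms uv by (simp add: powr_mult)
      also have "u powr (-1/4) * v powr (-1/4) \<le> ((u powr (-1/4))\<^sup>2 + (v powr (-1/4))\<^sup>2) / 2"
        using zero_le_power2[of "u powr (-1/4) - v powr (-1/4)"] by (simp add: power2_eq_square algebra_simps)
      also have "\<dots> = (u powr (-1/2) + v powr (-1/2)) / 2"
        by (simp add: power2_eq_square powr_add[symmetric])
      finally show ?case
        unfolding eq u_def[symmetric] v_def[symmetric] by (simp add: mult_left_mono)
    qed
    show "integrable circ (\<lambda>t. exp (- (l * cmod (a + b * cis t + c * (cis t)\<^sup>2))\<^sup>2 / 2))"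
      by (intro circ.integrable_const_bound[where B = 1]) auto
  qed (intro integrable_mult_right Bochner_Integration.integrable_add integrable_circ_inverse_sqrt)
  also have "\<dots> = l powr (-1/4) / 2 * ((\<integral>t. cmod (cis t - \<alpha>) powr (-1/2) \<partial>circ) + (\<integral>t. cmod (cis t - \<beta>) powr (-1/2) \<partial>circ))"
    using integrable_circ_inverse_sqrt[of \<alpha>] integrable_circ_inverse_sqrt[of \<beta>] by simp
  also have "\<dots> \<le> l powr (-1/4) / 2 * (10 + 10)"
    by (intro mult_left_mono add_mono integral_circ_inverse_sqrt_le) auto
  finally show ?thesis by simp
qed

section \<open>The lower tail of the logarithm\<close>

definition energy :: "nat \<Rightarrow> (nat \<Rightarrow> real) \<Rightarrow> real \<Rightarrow> real" where
  "energy n x t = (cmod (walk n x (cis t)))\<^sup>2 / n"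

lemma energy_nonneg: "0 \<le> energy n x t"
  by (simp add: energy_def)

lemma measurable_energy [measurable]: "energy n x \<in> borel_measurable borel"
  unfolding energy_def walk_def by measurable

text \<open>The comparison walk with r = 3 is a random quadratic polynomial whose coefficients are three
  independent sums of m signs.\<close>

lemma sign_mean_three_blocks:
  fixes m :: nat and z :: complex
  defines "p \<equiv> \<lambda>j. real (m choose j) / 2 ^ m"
    and "q \<equiv> \<lambda>j. 2 * real j - real m"
  shows "sign_mean (3 * m) (\<lambda>x. H (\<Sum>k<3 * m. of_real (x k) * z ^ (k div m)))
    = (\<Sum>i\<le>m. p i * (\<Sum>j\<le>m. p j * (\<Sum>k\<le>m. p k * H (of_real (q i) + of_real (q j) * z + of_real (q k) * z\<^sup>2))))"
proof -
  have grp: "(\<Sum>k<3 * m. of_real (x k) * z ^ (k div m))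
      = of_real (\<Sum>k<m. x k) + of_real (\<Sum>k<m. x (m + k)) * z + of_real (\<Sum>k<m. x (2 * m + k)) * z\<^sup>2"
    for x :: "nat \<Rightarrow> real"
  proof -
    have "(\<Sum>k<3 * m. of_real (x k) * z ^ (k div m))
        = (\<Sum>i<3. \<Sum>k\<in>{i * m..<i * m + m}. of_real (x k) * z ^ (k div m))"
      by (rule sum.nat_group[symmetric])
    also have "\<dots> = (\<Sum>i<3. \<Sum>k<m. of_real (x (i * m + k)) * z ^ i)"
    proof (rule sum.cong[OF refl])
      fix i
      have "(\<Sum>k\<in>{i * m..<i * m + m}. of_real (x k) * z ^ (k div m))
          = (\<Sum>k<m. of_real (x (i * m + k)) * z ^ ((i * m + k) div m))"
        using sum.shift_bounds_nat_ivl[of "\<lambda>k. of_real (x k) * z ^ (k div m)" 0 "i * m" m]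
        by (simp add: add.commute atLeast0LessThan)
      also have "\<dots> = (\<Sum>k<m. of_real (x (i * m + k)) * z ^ i)"
        by (intro sum.cong refl) auto
      finally show "(\<Sum>k\<in>{i * m..<i * m + m}. of_real (x k) * z ^ (k div m))
          = (\<Sum>k<m. of_real (x (i * m + k)) * z ^ i)" .
    qed
    also have "\<dots> = of_real (\<Sum>k<m. x k) + of_real (\<Sum>k<m. x (m + k)) * z + of_real (\<Sum>k<m. x (2 * m + k)) * z\<^sup>2"
    proof -
      have "{..<3} = {0, 1, 2 :: nat}" by auto
      then show ?thesis by (simp add: sum_distrib_right)
    qed
    finally show ?thesis .
  qed
  define F where "F a b c = H (of_real a + of_real b * z + of_real c * z\<^sup>2)" for a b c
  have "sign_mean (3 * m) (\<lambda>x. H (\<Sum>k<3 * m. of_real (x k) * z ^ (k div m)))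
      = sign_mean (m + (m + m)) (\<lambda>x. F (\<Sum>k<m. x k) (\<Sum>k<m. x (m + k)) (\<Sum>k<m. x (2 * m + k)))"
  proof -
    have "sign_mean (3 * m) (\<lambda>x. H (\<Sum>k<3 * m. of_real (x k) * z ^ (k div m)))
        = sign_mean (3 * m) (\<lambda>x. F (\<Sum>k<m. x k) (\<Sum>k<m. x (m + k)) (\<Sum>k<m. x (2 * m + k)))"
      by (rule sign_mean_cong) (simp only: F_def grp)
    also have "\<dots> = sign_mean (m + (m + m)) (\<lambda>x. F (\<Sum>k<m. x k) (\<Sum>k<m. x (m + k)) (\<Sum>k<m. x (2 * m + k)))"
      by (rule arg_cong2[where f = sign_mean]) simp_all
    finally show ?thesis .
  qed
  also have "\<dots> = sign_mean m (\<lambda>x. sign_mean m (\<lambda>y. sign_mean m (\<lambda>w. F (\<Sum>k<m. x k) (\<Sum>k<m. y k) (\<Sum>k<m. w k))))"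
    by (simp add: sign_mean_split)
  also have "\<dots> = (\<Sum>i\<le>m. p i * (\<Sum>j\<le>m. p j * (\<Sum>k\<le>m. p k * F (q i) (q j) (q k))))"
    unfolding sign_mean_of_sum[where F = "\<lambda>c. F a b c" for a b]
      sign_mean_of_sum[where F = "\<lambda>b. \<Sum>k\<le>m. real (m choose k) / 2 ^ m * F a b (2 * real k - real m)" for a]
      sign_mean_of_sum[where F = "\<lambda>a. \<Sum>j\<le>m. real (m choose j) / 2 ^ m * (\<Sum>k\<le>m. real (m choose k) / 2 ^ m * F a (2 * real j - real m) (2 * real k - real m))"]
      p_def q_def ..
  finally show ?thesis by (simp add: F_def)
qed

lemma integral_circ_exp_real_quadratic_le:
  fixes a b c :: real
  assumes "a \<noteq> 0 \<longrightarrow> 1 \<le> \<bar>a\<bar>" "b \<noteq> 0 \<longrightarrow> 1 \<le> \<bar>b\<bar>" "c \<noteq> 0 \<longrightarrow> 1 \<le> \<bar>c\<bar>"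
    and "a \<noteq> 0 \<or> b \<noteq> 0 \<or> c \<noteq> 0" and l: "0 < l"
  shows "(\<integral>t. exp (- (l * cmod (of_real a + of_real b * cis t + of_real c * (cis t)\<^sup>2))\<^sup>2 / 2) \<partial>circ)
    \<le> 10 * l powr (-1/4)"
proof -
  \<comment> \<open>Multiplying by a power of z keeps the modulus on the circle and brings the degree up to two.\<close>
  consider "c \<noteq> 0" | "c = 0" "b \<noteq> 0" | "c = 0" "b = 0" "a \<noteq> 0" using assms by blast
  then show ?thesis
  proof cases
    case 1
    then show ?thesis using integral_circ_exp_quadratic_le[of "of_real c" l "of_real a" "of_real b"] assms by simp
  next
    case 2
    have "cmod (of_real a + of_real b * cis t) = cmod (0 + of_real a * cis t + of_real b * (cis t)\<^sup>2)" for t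
    proof -
      have "0 + of_real a * cis t + of_real b * (cis t)\<^sup>2 = cis t * (of_real a + of_real b * cis t)"
        by (simp add: algebra_simps power2_eq_square)
      then show ?thesis by (simp add: norm_mult)
    qed
    then show ?thesis
      using 2 integral_circ_exp_quadratic_le[of "of_real b" l 0 "of_real a"] assms by simp
  next
    case 3
    have "cmod (of_real a) = cmod (0 + 0 * cis t + of_real a * (cis t)\<^sup>2)" for t
      by (simp add: norm_mult norm_power)
    then show ?thesis
      using 3 integral_circ_exp_quadratic_le[of "of_real a" l 0 0] assms
      by (simp add: norm_mult norm_power)
  qed
qed

text \<open>The first summand is the probability that all three coefficients vanish. In the remaining event
  one of them has modulus at least one, and averaging over the circle gives the second summand.\<close>

lemma integral_three_blocks_le:
  assumes l: "0 < l"
  shows "(\<integral>t. sign_mean (3 * (2 * h)) (\<lambda>x. exp (- (l * cmod (\<Sum>k<3 * (2 * h). of_real (x k) * cis t ^ (k div (2 * h))))\<^sup>2 / 2)) \<partial>circ)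
    \<le> (1 / sqrt (2 * real h + 1)) ^ 3 + 10 * l powr (-1/4)"
proof -
  define m where "m = 2 * h"
  define p where "p j = real (m choose j) / 2 ^ m" for j
  define q where "q j = 2 * real j - real m" for j
  define E where "E = 10 * l powr (-1/4)"
  define F where "F i j k t = exp (- (l * cmod (of_real (q i) + of_real (q j) * cis t + of_real (q k) * (cis t)\<^sup>2))\<^sup>2 / 2)" for i j k t
  have p0: "0 \<le> p j" for j by (simp add: p_def)
  have psum: "(\<Sum>j\<le>m. p j) = 1"
    using choose_row_sum[of m, THEN arg_cong, of real]
    by (simp add: p_def sum_divide_distrib[symmetric])
  have E0: "0 \<le> E" by (simp add: E_def)
  have q0: "q j = 0 \<longleftrightarrow> j = h" and q1: "q j \<noteq> 0 \<longrightarrow> 1 \<le> \<bar>q j\<bar>" for j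
  proof -
    have "q j = 2 * of_int (int j - int h)" by (simp add: q_def m_def)
    then show "q j = 0 \<longleftrightarrow> j = h" "q j \<noteq> 0 \<longrightarrow> 1 \<le> \<bar>q j\<bar>" by auto
  qed
  have int [simp]: "integrable circ (F i j k)" for i j k
    unfolding F_def by (intro circ.integrable_const_bound[where B = 1]) auto
  have F_le: "(\<integral>t. F i j k t \<partial>circ) \<le> of_bool (i = h) * (of_bool (j = h) * of_bool (k = h)) + E" for i j k
  proof (cases "i = h \<and> j = h \<and> k = h")
    case True
    have "(\<integral>t. F i j k t \<partial>circ) \<le> (\<integral>t. 1 \<partial>circ)"
      by (rule integral_mono[OF int]) (auto simp: F_def)
    then show ?thesis using True E0 by simp
  next
    case False
    then have "(\<integral>t. F i j k t \<partial>circ) \<le> E"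
      unfolding F_def E_def using q0 q1 l by (intro integral_circ_exp_real_quadratic_le) auto
    then show ?thesis by (rule order_trans) simp
  qed
  have "(\<integral>t. sign_mean (3 * m) (\<lambda>x. exp (- (l * cmod (\<Sum>k<3 * m. of_real (x k) * cis t ^ (k div m)))\<^sup>2 / 2)) \<partial>circ)
      = (\<integral>t. (\<Sum>i\<le>m. p i * (\<Sum>j\<le>m. p j * (\<Sum>k\<le>m. p k * F i j k t))) \<partial>circ)"
    unfolding sign_mean_three_blocks[where H = "\<lambda>s. exp (- (l * cmod s)\<^sup>2 / 2)"] F_def p_def q_def ..
  also have "\<dots> = (\<Sum>i\<le>m. p i * (\<Sum>j\<le>m. p j * (\<Sum>k\<le>m. p k * (\<integral>t. F i j k t \<partial>circ))))"
    by simp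
  also have "\<dots> \<le> (\<Sum>i\<le>m. p i * (\<Sum>j\<le>m. p j * (\<Sum>k\<le>m. p k * (of_bool (i = h) * (of_bool (j = h) * of_bool (k = h)) + E))))"
    by (intro sum_mono mult_left_mono F_le p0)
  also have "\<dots> = (\<Sum>i\<le>m. p i * of_bool (i = h)) * ((\<Sum>j\<le>m. p j * of_bool (j = h)) * (\<Sum>k\<le>m. p k * of_bool (k = h)))
      + (\<Sum>i\<le>m. p i) * ((\<Sum>j\<le>m. p j) * (\<Sum>k\<le>m. p k)) * E"
    by (simp only: distrib_left sum.distrib sum_distrib_left sum_distrib_right mult_ac)
  also have "(\<Sum>j\<le>m. p j * of_bool (j = h)) = p h"
    by (simp add: m_def of_bool_def if_distrib[of "\<lambda>x. _ * x"] sum.delta cong: if_cong)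
  also have "p h * (p h * p h) + (\<Sum>i\<le>m. p i) * ((\<Sum>j\<le>m. p j) * (\<Sum>k\<le>m. p k)) * E = p h ^ 3 + E"
    by (simp add: psum power3_eq_cube mult_ac)
  also have "\<dots> \<le> (1 / sqrt (2 * real h + 1)) ^ 3 + E"
    using central_binomial_upper_bound[of h] p0[of h]
    by (intro add_right_mono power_mono) (auto simp: p_def m_def)
  finally show ?thesis by (simp add: m_def E_def)
qed

lemma small_ball_average:
  assumes n: "6 \<le> n" and l: "0 < l"
  shows "sign_mean n (\<lambda>x. \<integral>t. (if energy n x t \<le> 1 / (n * l\<^sup>2) then 1 else 0) \<partial>circ)
    \<le> 2 * ((sqrt (6 / n)) ^ 3 + 10 * l powr (-1/4))"
proof -
  define h where "h = n div 6"
  have h: "0 < h" "3 * (2 * h) \<le> n" "n \<le> 6 * (2 * h + 1)" using n by (auto simp: h_def)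
  have *: "energy n x t \<le> 1 / (n * l\<^sup>2) \<longleftrightarrow> (l * cmod (walk n x (cis t)))\<^sup>2 \<le> 1" for x t
    using n l by (simp add: energy_def power_mult_distrib field_simps)
  have int: "integrable circ (\<lambda>t. exp (- (l * cmod (walk n x (cis t)))\<^sup>2 / 2))" for x
    by (intro circ.integrable_const_bound[where B = 1]) (auto simp: walk_def)
  have int': "integrable circ (\<lambda>t. exp (- (l * cmod (\<Sum>k<3 * (2 * h). of_real (x k) * cis t ^ (k div (2 * h))))\<^sup>2 / 2))" for x
    by (intro circ.integrable_const_bound[where B = 1]) auto
  have "sign_mean n (\<lambda>x. \<integral>t. (if energy n x t \<le> 1 / (n * l\<^sup>2) then 1 else 0) \<partial>circ)
      \<le> sign_mean n (\<lambda>x. \<integral>t. 2 * exp (- (l * cmod (walk n x (cis t)))\<^sup>2 / 2) \<partial>circ)"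
  proof (intro sign_mean_mono integral_mono)
    fix x t
    show "(if energy n x t \<le> 1 / (n * l\<^sup>2) then 1 else 0) \<le> 2 * exp (- (l * cmod (walk n x (cis t)))\<^sup>2 / 2)"
      unfolding * by (rule indicator_le_exp)
    show "integrable circ (\<lambda>t. if energy n x t \<le> 1 / (n * l\<^sup>2) then 1 else 0 :: real)"
      by (intro circ.integrable_const_bound[where B = 1]) auto
  qed (intro integrable_mult_right int)
  also have "\<dots> = 2 * sign_mean n (\<lambda>x. \<integral>t. exp (- (l * cmod (walk n x (cis t)))\<^sup>2 / 2) \<partial>circ)"
    by (simp add: sign_mean_cmult)
  also have "sign_mean n (\<lambda>x. \<integral>t. exp (- (l * cmod (walk n x (cis t)))\<^sup>2 / 2) \<partial>circ)
      = (\<integral>t. sign_mean n (\<lambda>x. exp (- (l * cmod (walk n x (cis t)))\<^sup>2 / 2)) \<partial>circ)"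
    by (rule sign_mean_integral[symmetric]) (rule int)
  also have "\<dots> \<le> (\<integral>t. sign_mean (3 * (2 * h)) (\<lambda>x. exp (- (l * cmod (\<Sum>k<3 * (2 * h). of_real (x k) * cis t ^ (k div (2 * h))))\<^sup>2 / 2)) \<partial>circ)"
  proof (rule integral_mono)
    show "sign_mean n (\<lambda>x. exp (- (l * cmod (walk n x (cis t)))\<^sup>2 / 2))
        \<le> sign_mean (3 * (2 * h)) (\<lambda>x. exp (- (l * cmod (\<Sum>k<3 * (2 * h). of_real (x k) * cis t ^ (k div (2 * h))))\<^sup>2 / 2))" for t
      by (rule block_comparison) (use h in auto)
    show "integrable circ (\<lambda>t. sign_mean n (\<lambda>x. exp (- (l * cmod (walk n x (cis t)))\<^sup>2 / 2)))"
      unfolding sign_mean_def by (intro integrable_divide_zero Bochner_Integration.integrable_sum int)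
    show "integrable circ (\<lambda>t. sign_mean (3 * (2 * h)) (\<lambda>x. exp (- (l * cmod (\<Sum>k<3 * (2 * h). of_real (x k) * cis t ^ (k div (2 * h))))\<^sup>2 / 2)))"
      unfolding sign_mean_def by (intro integrable_divide_zero Bochner_Integration.integrable_sum int')
  qed
  also have "\<dots> \<le> (1 / sqrt (2 * real h + 1)) ^ 3 + 10 * l powr (-1/4)"
    by (rule integral_three_blocks_le[OF l])
  also have "\<dots> \<le> (sqrt (6 / n)) ^ 3 + 10 * l powr (-1/4)"
  proof -
    have "1 / (2 * real h + 1) \<le> 6 / n"
    proof -
      have "real n \<le> real (6 * (2 * h + 1))" using h(3) by (simp only: of_nat_le_iff)
      then show ?thesis using n by (simp add: field_simps)
    qed
    then have "1 / sqrt (2 * real h + 1) \<le> sqrt (6 / n)"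
      using real_sqrt_le_mono by (fastforce simp: real_sqrt_divide)
    then show ?thesis by (intro add_right_mono power_mono) auto
  qed
  finally show ?thesis by simp
qed

text \<open>The polynomial has a leading coefficient of modulus one, so its modulus is the product of the
  distances to its roots.\<close>

lemma walk_roots:
  assumes "x \<in> signs n" "0 < n"
  shows "\<exists>r. \<forall>z. cmod (walk n x z) = (\<Prod>i<n - 1. cmod (z - r i))"
proof -
  define p where "p = (\<Sum>k<n. monom (complex_of_real (x k)) k)"
  have coeff: "coeff p j = (if j < n then of_real (x j) else 0)" for j
    by (simp add: p_def coeff_sum if_distrib cong: if_cong)
  have top: "coeff p (n - 1) = of_real (x (n - 1))" using assms(2) by (simp add: coeff)
  have x1: "x (n - 1) = 1 \<or> x (n - 1) = -1" using signs_cases[OF assms(1), of "n - 1"] assms(2) by auto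
  have deg: "degree p = n - 1"
  proof (rule antisym)
    show "degree p \<le> n - 1" by (rule degree_le) (auto simp: coeff)
    show "n - 1 \<le> degree p" by (rule le_degree) (use top x1 in auto)
  qed
  have "p \<noteq> 0" using top x1 by auto
  then obtain A where A: "size A = n - 1" "p = smult (of_real (x (n - 1))) (\<Prod>a\<in>#A. [:-a, 1:])"
    using alg_closed_imp_factorization[of p] deg top by auto
  obtain as where as: "mset as = A" using ex_mset by blast
  have len: "length as = n - 1" using A(1) as by auto
  have "cmod (walk n x z) = (\<Prod>i<n - 1. cmod (z - as ! i))" for z
  proof -
    have "poly p z = walk n x z" by (simp add: p_def walk_def poly_sum poly_monom)
    moreover have "poly p z = of_real (x (n - 1)) * poly (\<Prod>a\<leftarrow>as. [:-a, 1:]) z"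
      unfolding A(2) as[symmetric] by (simp flip: prod_mset_prod_list)
    moreover have "poly (\<Prod>a\<leftarrow>as. [:-a, 1:]) z = (\<Prod>i<n - 1. z - as ! i)"
      by (simp add: prod.list_conv_set_nth len atLeast0LessThan poly_prod)
    ultimately have "cmod (walk n x z) = cmod (of_real (x (n - 1))) * cmod (\<Prod>i<n - 1. z - as ! i)"
      by (metis norm_mult)
    then show ?thesis using x1 by (auto simp: prod_norm)
  qed
  then show ?thesis by blast
qed

text \<open>Where Y \<le> \<open>\<kappa>\<close>, the logarithm is at most twice the sum of ln (1 / u) over the distances u to the
  n - 1 roots, because \<open>\<kappa>\<close> n \<le> 1. Each term exceeds ln (1 / \<open>\<tau>\<close>) by at most the integrable function
  2 sqrt (\<open>\<tau>\<close> / u). For small \<open>\<tau>\<close> the bound is therefore essentially 2 n ln (1 / \<open>\<tau>\<close>) times the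
  measure of the set where Y \<le> \<open>\<kappa>\<close>.\<close>

lemma log_deep_bound:
  assumes x: "x \<in> signs n" and n: "0 < n" and \<tau>: "0 < \<tau>" "\<tau> \<le> 1" and \<kappa>: "0 < \<kappa>" "\<kappa> * n \<le> 1"
  shows "integrable circ (\<lambda>t. max 0 (ln (\<kappa> / energy n x t)))" (is ?int)
    and "(\<integral>t. max 0 (ln (\<kappa> / energy n x t)) \<partial>circ)
      \<le> 2 * real n * ln (1 / \<tau>) * (\<integral>t. (if energy n x t \<le> \<kappa> then 1 else 0) \<partial>circ) + 40 * real n * sqrt \<tau>" (is ?bound)
proof -
  obtain r where r: "\<And>z. cmod (walk n x z) = (\<Prod>i<n - 1. cmod (z - r i))"
    using walk_roots[OF x n] by blast
  define B where "B t = 2 * real n * ln (1 / \<tau>) * (if energy n x t \<le> \<kappa> then 1 else 0)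
      + 4 * sqrt \<tau> * (\<Sum>i<n - 1. cmod (cis t - r i) powr (-1/2))" for t
  have ln\<tau>: "0 \<le> ln (1 / \<tau>)" using \<tau> by simp
  have neg_ln: "- ln u \<le> ln (1 / \<tau>) + 2 * sqrt \<tau> * u powr (-1/2)" if "0 < u" for u :: real
  proof -
    have "ln (sqrt (\<tau> / u)) \<le> sqrt (\<tau> / u)"
      using that \<tau> by (intro ln_bound) simp
    moreover have "ln (\<tau> / u) = 2 * ln (sqrt (\<tau> / u))"
      using that \<tau> by (simp add: ln_sqrt)
    moreover have "sqrt (\<tau> / u) = sqrt \<tau> * u powr (-1/2)"
      using that by (simp add: real_sqrt_divide powr_minus_divide powr_half_sqrt)
    ultimately show ?thesis using that \<tau> by (simp add: ln_div)
  qed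
  have lnQ: "ln (\<kappa> / (Q\<^sup>2 / n)) = ln (\<kappa> * n) + - (2 * ln Q)" if "0 < Q" for Q
    using that \<kappa> n by (simp add: ln_div ln_mult ln_realpow)
  have AE: "AE t in circ. max 0 (ln (\<kappa> / energy n x t)) \<le> B t"
  proof -
    have "AE t in circ. \<forall>i\<in>{..<n - 1}. cis t \<noteq> r i"
      by (intro AE_finite_allI AE_circ_cis_neq) auto
    then show ?thesis
    proof eventually_elim
      case (elim t)
      define u where "u i = cmod (cis t - r i)" for i
      have u: "0 < u i" if "i < n - 1" for i using elim that by (auto simp: u_def)
      have e: "energy n x t = (\<Prod>i<n - 1. u i)\<^sup>2 / n" by (simp add: energy_def r u_def)
      have P: "0 < (\<Prod>i<n - 1. u i)" by (intro prod_pos) (use u in auto)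
      have S: "0 \<le> (\<Sum>i<n - 1. cmod (cis t - r i) powr (-1/2))" by (intro sum_nonneg) auto
      have B0: "0 \<le> B t" unfolding B_def using ln\<tau> \<tau> S by auto
      have "ln (\<kappa> / energy n x t) \<le> B t"
      proof (cases "energy n x t \<le> \<kappa>")
        case True
        have "ln (\<kappa> / energy n x t) = ln (\<kappa> * n) + - (2 * ln (\<Prod>i<n - 1. u i))"
          unfolding e by (rule lnQ[OF P])
        also have "\<dots> \<le> 0 + - (2 * ln (\<Prod>i<n - 1. u i))"
          using \<kappa> n by (intro add_right_mono) simp
        also have "ln (\<Prod>i<n - 1. u i) = (\<Sum>i<n - 1. ln (u i))"
          by (rule ln_prod) (use u in \<open>auto simp: less_le\<close>)
        also have "0 + - (2 * (\<Sum>i<n - 1. ln (u i))) = 2 * (\<Sum>i<n - 1. - ln (u i))"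
          by (simp add: sum_negf)
        also have "\<dots> \<le> 2 * (\<Sum>i<n - 1. ln (1 / \<tau>) + 2 * sqrt \<tau> * u i powr (-1/2))"
          by (intro mult_left_mono sum_mono neg_ln) (use u in auto)
        also have "\<dots> = 2 * real (n - 1) * ln (1 / \<tau>) + 4 * sqrt \<tau> * (\<Sum>i<n - 1. u i powr (-1/2))"
          by (simp add: sum.distrib sum_distrib_left[symmetric] algebra_simps)
        also have "\<dots> \<le> 2 * real n * ln (1 / \<tau>) + 4 * sqrt \<tau> * (\<Sum>i<n - 1. u i powr (-1/2))"
          using ln\<tau> by (intro add_right_mono mult_right_mono) auto
        finally show ?thesis using True by (simp add: B_def u_def)
      next
        case False
        then have "ln (\<kappa> / energy n x t) \<le> 0" using \<kappa> by (intro ln_le_zero_iff[THEN iffD2]) (auto simp: field_simps)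
        then show ?thesis using B0 by simp
      qed
      then show ?case using B0 by simp
    qed
  qed
  have intI: "integrable circ (\<lambda>t. if energy n x t \<le> \<kappa> then 1 else 0 :: real)"
    by (intro circ.integrable_const_bound[where B = 1]) auto
  have intB: "integrable circ B"
    unfolding B_def by (intro Bochner_Integration.integrable_add integrable_mult_right intI
        Bochner_Integration.integrable_sum integrable_circ_inverse_sqrt)
  show ?int
  proof (rule Bochner_Integration.integrable_bound[OF intB])
    show "AE t in circ. norm (max 0 (ln (\<kappa> / energy n x t))) \<le> norm (B t)"
      using AE by eventually_elim simp
  qed measurable
  then have "(\<integral>t. max 0 (ln (\<kappa> / energy n x t)) \<partial>circ) \<le> (\<integral>t. B t \<partial>circ)"
    by (intro integral_mono_AE intB AE)
  also have "\<dots> = 2 * real n * ln (1 / \<tau>) * (\<integral>t. (if energy n x t \<le> \<kappa> then 1 else 0) \<partial>circ)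
      + 4 * sqrt \<tau> * (\<Sum>i<n - 1. \<integral>t. cmod (cis t - r i) powr (-1/2) \<partial>circ)"
    unfolding B_def
    using intI integrable_circ_inverse_sqrt[simplified] by simp
  also have "\<dots> \<le> 2 * real n * ln (1 / \<tau>) * (\<integral>t. (if energy n x t \<le> \<kappa> then 1 else 0) \<partial>circ)
      + 4 * sqrt \<tau> * (\<Sum>i<n - 1. 10)"
    by (intro add_left_mono mult_left_mono sum_mono integral_circ_inverse_sqrt_le) (use \<tau> in auto)
  also have "\<dots> \<le> 2 * real n * ln (1 / \<tau>) * (\<integral>t. (if energy n x t \<le> \<kappa> then 1 else 0) \<partial>circ) + 40 * real n * sqrt \<tau>"
    using \<tau> by (simp add: mult_right_mono)
  finally show ?bound .
qed

text \<open>With L = ln (d / y) the claim is max 0 L \<le> (number of j < J with j \<le> L) + max 0 (L - J), a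
  discrete form of the layer cake formula.\<close>

lemma log_layers:
  fixes y d :: real
  assumes "0 \<le> y" "0 < d"
  shows "max 0 (ln (d / y))
    \<le> (\<Sum>j<J. if y \<le> d * exp (- real j) then 1 else 0) + max 0 (ln (d * exp (- real J) / y))"
proof (cases "y = 0")
  case False
  then have y: "0 < y" using assms by simp
  show ?thesis
  proof (induction J)
    case (Suc J)
    have 1: "ln (d * exp (- real j) / y) = ln (d / y) - real j" for j
      using y assms by (simp add: ln_div ln_mult)
    have 2: "y \<le> d * exp (- real J) \<longleftrightarrow> 0 \<le> ln (d / y) - real J"
      unfolding 1[symmetric] using y assms by (simp add: field_simps)
    show ?case using Suc.IH unfolding sum.lessThan_Suc 1 2 by (auto split: if_splits)
  qed simp
qed (simp add: sum_nonneg)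

text \<open>The logarithm is split at depth 13 ln n. Above it, about 13 ln n layers are estimated by
  \<open>small_ball_pointwise\<close>; their errors 1 / sqrt n add up to ln n / sqrt n and their main terms to a convergent
  geometric series. Below it, \<open>log_deep_bound\<close> applies with \<open>\<tau>\<close> = n^(-4), where
  \<open>small_ball_average\<close> with l = n^6 bounds the measure by a multiple of n^(-3/2): the exponent 6 makes
  l^(-1/4) of the same order as the probability that all three coefficients vanish, and 13 = 2 * 6 + 1
  because Y \<le> 1 / (n l^2) is the condition |S| \<le> 1 / l.\<close>

lemma lower_tail:
  assumes n: "6 \<le> n" and d: "0 < d" "d \<le> 1"
  shows "x \<in> signs n \<Longrightarrow> integrable circ (\<lambda>t. max 0 (ln (d / energy n x t)))"
    and "sign_mean n (\<lambda>x. \<integral>t. max 0 (ln (d / energy n x t)) \<partial>circ)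
      \<le> 12 * sqrt d + ((504 * ln n + 8) / sqrt n + 40 / n)"
proof -
  define l where "l = real n ^ 6"
  define \<kappa> where "\<kappa> = 1 / (n * l\<^sup>2)"
  define \<tau> where "\<tau> = 1 / real n ^ 4"
  define J where "J = nat \<lceil>13 * ln n\<rceil>"
  have n1: "1 \<le> real n" "0 < n" using n by auto
  have l: "0 < l" using n by (simp add: l_def)
  have \<tau>: "0 < \<tau>" "\<tau> \<le> 1" using n by (auto simp: \<tau>_def)
  have \<kappa>_eq: "\<kappa> = 1 / real n ^ 13" by (simp add: \<kappa>_def l_def eval_nat_numeral)
  have \<kappa>: "0 < \<kappa>" "\<kappa> * n \<le> 1"
    using n1 l by (auto simp: \<kappa>_def l_def)
  have J: "13 * ln n \<le> J" "J \<le> 13 * ln n + 1"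
    using n1 by (auto simp: J_def)
  have dJ: "d * exp (- real J) \<le> \<kappa>"
  proof -
    have "d * exp (- real J) \<le> 1 * exp (- (13 * ln n))"
      using d J by (intro mult_mono) auto
    also have "\<dots> = \<kappa>"
      using n1 by (simp add: \<kappa>_eq exp_minus exp_of_nat_mult[of 13 "ln n", simplified] divide_inverse)
    finally show ?thesis .
  qed
  define I where "I e x t = (if energy n x t \<le> e then 1 else 0 :: real)" for e x t
  have intI: "integrable circ (I e x)" for e x
    unfolding I_def by (intro circ.integrable_const_bound[where B = 1]) auto
  define B where "B x t = (\<Sum>j<J. I (d * exp (- real j)) x t) + max 0 (ln (\<kappa> / energy n x t))" for x t
  have le_B: "max 0 (ln (d / energy n x t)) \<le> B x t" for x t
  proof -
    have "max 0 (ln (d * exp (- real J) / energy n x t)) \<le> max 0 (ln (\<kappa> / energy n x t))"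
    proof (cases "energy n x t = 0")
      case False
      then have "0 < energy n x t" using energy_nonneg[of n x t] by simp
      then have "ln (d * exp (- real J) / energy n x t) \<le> ln (\<kappa> / energy n x t)"
        using d \<kappa> dJ by (intro ln_mono) (auto intro: divide_right_mono)
      then show ?thesis by simp
    qed simp
    then show ?thesis
      using log_layers[OF energy_nonneg[of n x t] d(1), of J] unfolding B_def I_def by linarith
  qed
  have intB: "integrable circ (B x)" if "x \<in> signs n" for x
    unfolding B_def
    by (intro Bochner_Integration.integrable_add Bochner_Integration.integrable_sum intI
        log_deep_bound(1)[OF that _ \<tau> \<kappa>]) (use n in auto)
  show int: "integrable circ (\<lambda>t. max 0 (ln (d / energy n x t)))" if "x \<in> signs n" for x
  proof (rule Bochner_Integration.integrable_bound[OF intB[OF that]])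
    have "norm (max 0 (ln (d / energy n x t))) \<le> norm (B x t)" for t
      using le_B[of x t] by simp
    then show "AE t in circ. norm (max 0 (ln (d / energy n x t))) \<le> norm (B x t)" by blast
  qed measurable
  have layer: "sign_mean n (\<lambda>x. \<integral>t. I e x t \<partial>circ) \<le> 8 / sqrt n + 4 * sqrt e" if "0 < e" for e
  proof -
    have "sign_mean n (\<lambda>x. \<integral>t. I e x t \<partial>circ) = (\<integral>t. sign_mean n (\<lambda>x. I e x t) \<partial>circ)"
      by (rule sign_mean_integral[symmetric]) (rule intI)
    also have "\<dots> \<le> (\<integral>t. 8 / sqrt n + 4 * sqrt e \<partial>circ)"
    proof (rule integral_mono)
      show "integrable circ (\<lambda>t. sign_mean n (\<lambda>x. I e x t))"
        unfolding sign_mean_def by (intro integrable_divide_zero Bochner_Integration.integrable_sum intI)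
      show "sign_mean n (\<lambda>x. I e x t) \<le> 8 / sqrt n + 4 * sqrt e" for t
        unfolding I_def energy_def using small_ball_pointwise[of n "cis t" e] n that by simp
    qed simp
    finally show ?thesis by simp
  qed
  have layers: "(\<Sum>j<J. sign_mean n (\<lambda>x. \<integral>t. I (d * exp (- real j)) x t \<partial>circ))
      \<le> J * (8 / sqrt n) + 12 * sqrt d"
  proof -
    define q where "q = exp (- (1 / 2) :: real)"
    have "3 / 2 \<le> exp (1 / 2 :: real)" using exp_ge_add_one_self[of "1 / 2 :: real"] by simp
    then have q: "0 \<le> q" "q \<le> 2 / 3" by (auto simp: q_def exp_minus field_simps)
    have sq: "sqrt (exp (- real j)) = q ^ j" for j
      by (rule real_sqrt_unique) (auto simp: q_def power_mult[symmetric] exp_of_nat_mult[symmetric])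
    have "(\<Sum>j<J. sign_mean n (\<lambda>x. \<integral>t. I (d * exp (- real j)) x t \<partial>circ))
        \<le> (\<Sum>j<J. 8 / sqrt n + 4 * sqrt (d * exp (- real j)))"
      by (intro sum_mono layer) (use d in auto)
    also have "\<dots> = J * (8 / sqrt n) + 4 * sqrt d * (\<Sum>j<J. q ^ j)"
      by (simp add: sum.distrib real_sqrt_mult sq sum_distrib_left mult.assoc)
    also have "(\<Sum>j<J. q ^ j) \<le> 3"
    proof -
      have "(\<Sum>j<J. q ^ j) = (1 - q ^ J) / (1 - q)"
        using q by (subst sum_gp_strict) auto
      also have "\<dots> \<le> 1 / (1 / 3)"
        using q by (intro frac_le) auto
      finally show ?thesis by simp
    qed
    finally show ?thesis using d by (simp add: mult_left_mono)
  qed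
  have "sign_mean n (\<lambda>x. \<integral>t. max 0 (ln (d / energy n x t)) \<partial>circ) \<le> sign_mean n (\<lambda>x. \<integral>t. B x t \<partial>circ)"
    by (intro sign_mean_mono integral_mono int intB le_B)
  also have "\<dots> = sign_mean n (\<lambda>x. (\<Sum>j<J. \<integral>t. I (d * exp (- real j)) x t \<partial>circ)
      + (\<integral>t. max 0 (ln (\<kappa> / energy n x t)) \<partial>circ))"
  proof (rule sign_mean_cong)
    fix x assume x: "x \<in> signs n"
    show "(\<integral>t. B x t \<partial>circ) = (\<Sum>j<J. \<integral>t. I (d * exp (- real j)) x t \<partial>circ)
      + (\<integral>t. max 0 (ln (\<kappa> / energy n x t)) \<partial>circ)"
      unfolding B_def
      using log_deep_bound(1)[OF x n1(2) \<tau> \<kappa>] intI by simp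
  qed
  also have "\<dots> = (\<Sum>j<J. sign_mean n (\<lambda>x. \<integral>t. I (d * exp (- real j)) x t \<partial>circ))
      + sign_mean n (\<lambda>x. \<integral>t. max 0 (ln (\<kappa> / energy n x t)) \<partial>circ)"
    by (simp add: sign_mean_add sign_mean_sum)
  also have "sign_mean n (\<lambda>x. \<integral>t. max 0 (ln (\<kappa> / energy n x t)) \<partial>circ)
      \<le> sign_mean n (\<lambda>x. 2 * real n * ln (1 / \<tau>) * (\<integral>t. I \<kappa> x t \<partial>circ) + 40 * real n * sqrt \<tau>)"
    unfolding I_def by (intro sign_mean_mono log_deep_bound(2) n1 \<tau> \<kappa>)
  also have "\<dots> = 2 * real n * ln (1 / \<tau>) * sign_mean n (\<lambda>x. \<integral>t. I \<kappa> x t \<partial>circ) + 40 * real n * sqrt \<tau>"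
    by (simp add: sign_mean_add sign_mean_cmult)
  also have "\<dots> \<le> 2 * real n * ln (1 / \<tau>) * (50 / sqrt n ^ 3) + 40 * real n * sqrt \<tau>"
  proof (intro add_right_mono mult_left_mono)
    have "sign_mean n (\<lambda>x. \<integral>t. I \<kappa> x t \<partial>circ) \<le> 2 * ((sqrt (6 / n)) ^ 3 + 10 * l powr (-1/4))"
      unfolding I_def \<kappa>_def by (rule small_ball_average[OF n l])
    also have "l powr (-1/4) = 1 / sqrt n ^ 3"
    proof -
      have "l = real n powr 6" using n1 by (simp add: l_def)
      then have "l powr (-1/4) = (real n powr 6) powr (-1/4)" by (simp only:)
      also have "\<dots> = (real n powr (1/2)) powr (-3)" by (simp only: powr_powr) simp
      also have "\<dots> = 1 / sqrt n ^ 3"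
        using n1 by (simp add: powr_half_sqrt powr_minus_divide)
      finally show ?thesis .
    qed
    also have "(sqrt (6 / n)) ^ 3 \<le> 15 / sqrt n ^ 3"
    proof -
      have "sqrt 6 \<le> 5 / 2" by (rule real_le_lsqrt) (auto simp: power2_eq_square)
      moreover have "sqrt 6 ^ 3 = 6 * sqrt 6" by (simp add: power3_eq_cube)
      ultimately have "sqrt 6 ^ 3 \<le> 15" by simp
      then show ?thesis by (simp add: real_sqrt_divide power_divide divide_right_mono)
    qed
    finally show "sign_mean n (\<lambda>x. \<integral>t. I \<kappa> x t \<partial>circ) \<le> 50 / sqrt n ^ 3" by simp
  qed (use \<tau> in auto)
  also have "2 * real n * ln (1 / \<tau>) * (50 / sqrt n ^ 3) + 40 * real n * sqrt \<tau> = 400 * ln n / sqrt n + 40 / n"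
  proof -
    have 1: "ln (1 / \<tau>) = 4 * ln n" using n1 by (simp add: \<tau>_def ln_realpow)
    have "sqrt (real n ^ 4) = real n ^ 2" by (rule real_sqrt_unique) simp_all
    then have 2: "sqrt \<tau> = 1 / real n ^ 2" by (simp add: \<tau>_def real_sqrt_divide)
    have 3: "sqrt n ^ 3 = n * sqrt n" using n1 by (simp add: power3_eq_cube)
    show ?thesis unfolding 1 2 3 using n1 by (simp add: power2_eq_square)
  qed
  also have "(\<Sum>j<J. sign_mean n (\<lambda>x. \<integral>t. I (d * exp (- real j)) x t \<partial>circ)) + (400 * ln n / sqrt n + 40 / n)
     \<le> ((13 * ln n + 1) * (8 / sqrt n) + 12 * sqrt d) + (400 * ln n / sqrt n + 40 / n)"
    using layers J by (intro add_right_mono order_trans[OF layers] mult_right_mono) auto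
  also have "\<dots> = 12 * sqrt d + ((504 * ln n + 8) / sqrt n + 40 / n)"
    by (simp add: add_divide_distrib algebra_simps)
  finally show "sign_mean n (\<lambda>x. \<integral>t. max 0 (ln (d / energy n x t)) \<partial>circ)
      \<le> 12 * sqrt d + ((504 * ln n + 8) / sqrt n + 40 / n)" by simp
qed

section \<open>The central limit theorem for Laplace transforms\<close>

lemma cos_minus_exp_le: "\<bar>cos t - exp (- t\<^sup>2 / 2)\<bar> \<le> t ^ 4" for t :: real
proof -
  obtain v where "cos t = (\<Sum>m<4. cos_coeff m * t ^ m) + (cos (v + 1/2 * real 4 * pi) / fact 4) * t ^ 4"
    using Maclaurin_cos_expansion[of t 4] by blast
  moreover have "(\<Sum>m<4. cos_coeff m * t ^ m) = 1 - t\<^sup>2 / 2"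
  proof -
    have "{..<4} = {0, 1, 2, 3 :: nat}" by auto
    then show ?thesis by (simp add: cos_coeff_def fact_numeral)
  qed
  ultimately have "\<bar>cos t - (1 - t\<^sup>2 / 2)\<bar> = \<bar>cos (v + 1/2 * real 4 * pi)\<bar> * t ^ 4 / 24"
    by (simp add: abs_mult fact_numeral)
  also have "\<dots> \<le> 1 * t ^ 4 / 24"
    by (intro divide_right_mono mult_right_mono abs_cos_le_one) auto
  finally have 1: "\<bar>cos t - (1 - t\<^sup>2 / 2)\<bar> \<le> t ^ 4 / 24" by simp
  define u where "u = t\<^sup>2 / 2"
  have u: "0 \<le> u" by (simp add: u_def)
  have "exp (- u) \<le> 1 / (1 + u)"
    using exp_ge_add_one_self[of u] u by (simp add: exp_minus field_simps)
  also have "\<dots> \<le> 1 - u + u\<^sup>2"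
    using u by (simp add: field_simps power2_eq_square)
  finally have "\<bar>exp (- u) - (1 - u)\<bar> \<le> u\<^sup>2"
    using exp_ge_add_one_self[of "- u"] by (simp add: abs_le_iff)
  moreover have "u\<^sup>2 = t ^ 4 / 4"
    by (simp add: u_def power_divide power_mult[symmetric])
  ultimately have 2: "\<bar>exp (- t\<^sup>2 / 2) - (1 - t\<^sup>2 / 2)\<bar> \<le> t ^ 4 / 4"
    by (simp add: u_def)
  have "0 \<le> t ^ 4" by simp
  with 1 2 show ?thesis by linarith
qed

text \<open>Replacing cos t by exp (- t^2 / 2) in every factor costs at most the sum of the fourth powers, which
  is of order 1 / n.\<close>

lemma prod_cos_tendsto:
  fixes t :: "nat \<Rightarrow> nat \<Rightarrow> real"
  assumes bound: "\<And>n k. k < n \<Longrightarrow> \<bar>t n k\<bar> \<le> B / sqrt n"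
    and lim: "(\<lambda>n. \<Sum>k<n. (t n k)\<^sup>2) \<longlonglongrightarrow> T"
  shows "(\<lambda>n. \<Prod>k<n. cos (t n k)) \<longlonglongrightarrow> exp (- T / 2)"
proof -
  have diff: "\<bar>(\<Prod>k<n. cos (t n k)) - exp (- (\<Sum>k<n. (t n k)\<^sup>2) / 2)\<bar> \<le> B ^ 4 / n" for n
  proof -
    have "exp (- (\<Sum>k<n. (t n k)\<^sup>2) / 2) = (\<Prod>k<n. exp (- (t n k)\<^sup>2 / 2))"
      by (simp add: exp_sum[symmetric] sum_negf sum_divide_distrib)
    then have "\<bar>(\<Prod>k<n. cos (t n k)) - exp (- (\<Sum>k<n. (t n k)\<^sup>2) / 2)\<bar>
        \<le> (\<Sum>k<n. \<bar>cos (t n k) - exp (- (t n k)\<^sup>2 / 2)\<bar>)"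
      using norm_prod_diff[of "{..<n}" "\<lambda>k. cos (t n k)" "\<lambda>k. exp (- (t n k)\<^sup>2 / 2)"] by simp
    also have "\<dots> \<le> (\<Sum>k<n. (B / sqrt n) ^ 4)"
    proof (rule sum_mono)
      fix k assume "k \<in> {..<n}"
      then have "\<bar>t n k\<bar> ^ 4 \<le> (B / sqrt n) ^ 4" using bound by (intro power_mono) auto
      then show "\<bar>cos (t n k) - exp (- (t n k)\<^sup>2 / 2)\<bar> \<le> (B / sqrt n) ^ 4"
        using cos_minus_exp_le[of "t n k"] by (simp add: power_even_abs)
    qed
    also have "\<dots> = B ^ 4 / n"
    proof -
      have "sqrt n ^ 4 = (sqrt n ^ 2) ^ 2" by (simp only: power_mult[symmetric]) simp
      then have "sqrt n ^ 4 = real n ^ 2" by simp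
      then show ?thesis by (simp add: power_divide power2_eq_square)
    qed
    finally show ?thesis .
  qed
  have "(\<lambda>n. (\<Prod>k<n. cos (t n k)) - exp (- (\<Sum>k<n. (t n k)\<^sup>2) / 2)) \<longlonglongrightarrow> 0"
    by (rule Lim_null_comparison[OF always_eventually lim_const_over_n[of "B ^ 4"]]) (use diff in simp)
  moreover have "(\<lambda>n. exp (- (\<Sum>k<n. (t n k)\<^sup>2) / 2)) \<longlonglongrightarrow> exp (- T / 2)"
    by (intro tendsto_intros lim) simp
  ultimately show ?thesis using tendsto_add by fastforce
qed

text \<open>A central limit theorem for d linear forms with asymptotically diagonal Gram matrix, in terms of
  Laplace transforms of squares. The pointwise limit inside the Gaussian integral suffices,
  because a product of cosines is bounded by one.\<close>

lemma sign_mean_exp_quadratic_tendsto: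
  fixes a :: "nat \<Rightarrow> nat \<Rightarrow> nat \<Rightarrow> real"
  assumes bound: "\<And>n i k. i < d \<Longrightarrow> k < n \<Longrightarrow> \<bar>a n i k\<bar> \<le> C / sqrt n"
    and gram: "\<And>i j. i < d \<Longrightarrow> j < d \<Longrightarrow>
        (\<lambda>n. \<Sum>k<n. a n i k * a n j k) \<longlonglongrightarrow> (if i = j then s i else 0)"
    and s: "\<And>i. i < d \<Longrightarrow> 0 \<le> s i"
  shows "(\<lambda>n. sign_mean n (\<lambda>x. exp (- (\<Sum>i<d. (\<Sum>k<n. a n i k * x k)\<^sup>2) / 2)))
    \<longlonglongrightarrow> (\<Prod>i<d. 1 / sqrt (1 + s i))"
proof -
  note measurable_gauss_component [measurable]
  interpret prob_space "gauss d" by (rule prob_space_gauss)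
  have "(\<lambda>n. \<Prod>k<n. cos (\<Sum>i<d. g i * a n i k)) \<longlonglongrightarrow> exp (- (\<Sum>i<d. s i * (g i)\<^sup>2) / 2)" for g
  proof (rule prod_cos_tendsto)
    fix n k :: nat assume "k < n"
    have "\<bar>\<Sum>i<d. g i * a n i k\<bar> \<le> (\<Sum>i<d. \<bar>g i\<bar> * \<bar>a n i k\<bar>)"
      by (rule order_trans[OF sum_abs]) (simp add: abs_mult)
    also have "\<dots> \<le> (\<Sum>i<d. \<bar>g i\<bar> * (C / sqrt n))"
      using bound \<open>k < n\<close> by (intro sum_mono mult_left_mono) auto
    finally show "\<bar>\<Sum>i<d. g i * a n i k\<bar> \<le> (\<Sum>i<d. \<bar>g i\<bar>) * C / sqrt n"
      by (simp add: sum_distrib_right sum_divide_distrib)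
  next
    have "(\<lambda>n. \<Sum>i<d. \<Sum>j<d. g i * g j * (\<Sum>k<n. a n i k * a n j k))
        \<longlonglongrightarrow> (\<Sum>i<d. \<Sum>j<d. g i * g j * (if i = j then s i else 0))"
      by (intro tendsto_sum tendsto_mult tendsto_const gram) auto
    also have "(\<lambda>n. \<Sum>i<d. \<Sum>j<d. g i * g j * (\<Sum>k<n. a n i k * a n j k)) = (\<lambda>n. \<Sum>k<n. (\<Sum>i<d. g i * a n i k)\<^sup>2)"
    proof
      fix n
      have "(\<Sum>k<n. (\<Sum>i<d. g i * a n i k)\<^sup>2) = (\<Sum>k<n. \<Sum>i<d. \<Sum>j<d. g i * g j * (a n i k * a n j k))"
        by (simp add: power2_eq_square sum_product mult_ac)
      also have "\<dots> = (\<Sum>i<d. \<Sum>k<n. \<Sum>j<d. g i * g j * (a n i k * a n j k))" by (rule sum.swap)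
      also have "\<dots> = (\<Sum>i<d. \<Sum>j<d. \<Sum>k<n. g i * g j * (a n i k * a n j k))"
        by (intro sum.cong refl sum.swap)
      finally show "(\<Sum>i<d. \<Sum>j<d. g i * g j * (\<Sum>k<n. a n i k * a n j k)) = (\<Sum>k<n. (\<Sum>i<d. g i * a n i k)\<^sup>2)"
        by (simp add: sum_distrib_left)
    qed
    also have "(\<Sum>i<d. \<Sum>j<d. g i * g j * (if i = j then s i else 0)) = (\<Sum>i<d. s i * (g i)\<^sup>2)"
      by (intro sum.cong refl) (simp add: if_distrib[of "\<lambda>x. _ * x"] power2_eq_square mult_ac cong: if_cong)
    finally show "(\<lambda>n. \<Sum>k<n. (\<Sum>i<d. g i * a n i k)\<^sup>2) \<longlonglongrightarrow> (\<Sum>i<d. s i * (g i)\<^sup>2)" .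
  qed
  then have "(\<lambda>n. \<integral>g. (\<Prod>k<n. cos (\<Sum>i<d. g i * a n i k)) \<partial>gauss d)
      \<longlonglongrightarrow> (\<integral>g. exp (- (\<Sum>i<d. s i * (g i)\<^sup>2) / 2) \<partial>gauss d)"
    by (intro integral_dominated_convergence[where w = "\<lambda>_. 1"] AE_I2)
       (auto simp: abs_prod intro!: prod_le_1)
  then show ?thesis
    by (simp only: sign_mean_exp_quadratic gauss_integral_exp_neg_square[OF s])
qed

lemma mean_power_tendsto:
  fixes u :: complex
  assumes "cmod u = 1"
  shows "(\<lambda>n. (\<Sum>k<n. u ^ k) / n) \<longlonglongrightarrow> (if u = 1 then 1 else 0)"
proof (cases "u = 1")
  case True
  have "\<forall>\<^sub>F n in sequentially. (\<Sum>k<n. u ^ k) / n = 1"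
    using eventually_gt_at_top[of 0] by eventually_elim (simp add: True)
  then show ?thesis using True tendsto_eventually by auto
next
  case False
  have "(\<lambda>n. (\<Sum>k<n. u ^ k) / n) \<longlonglongrightarrow> 0"
  proof (rule Lim_null_comparison[OF _ lim_const_over_n])
    have "norm ((\<Sum>k<n. u ^ k) / n) \<le> (2 / cmod (u - 1)) / n" for n
    proof -
      have "cmod (\<Sum>k<n. u ^ k) = cmod (u ^ n - 1) / cmod (u - 1)"
        using False by (simp add: geometric_sum norm_divide)
      also have "\<dots> \<le> 2 / cmod (u - 1)"
        using norm_triangle_ineq4[of "u ^ n" 1] assms by (intro divide_right_mono) (auto simp: norm_power)
      finally have "cmod (\<Sum>k<n. u ^ k) / n \<le> 2 / cmod (u - 1) / n"
        by (rule divide_right_mono) simp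
      then show ?thesis by (simp add: norm_divide)
    qed
    then show "\<forall>\<^sub>F n in sequentially. norm ((\<Sum>k<n. u ^ k) / of_nat n) \<le> (2 / cmod (u - 1)) / real n" by simp
  qed
  then show ?thesis using False by simp
qed

text \<open>The four linear forms are the real and imaginary parts of S at the two points. Their Gram matrix
  consists of averages of the powers of a product of two of these points or their conjugates, and
  such an average vanishes in the limit unless the product is 1. The hypotheses leave only the product
  of a point and its own conjugate, which contributes a real number to the diagonal entries and
  the real part of an imaginary number, hence nothing, to the entry for the real and imaginary parts
  at the same point.\<close>

lemma two_point_clt:
  fixes s s' t u :: real
  assumes "(cis t)\<^sup>2 \<noteq> 1" "(cis u)\<^sup>2 \<noteq> 1" "cis t * cis u \<noteq> 1" "cis t \<noteq> cis u" and s: "0 \<le> s" "0 \<le> s'"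
  shows "(\<lambda>n. sign_mean n (\<lambda>x. exp (- (s * energy n x t)) * exp (- (s' * energy n x u))))
    \<longlonglongrightarrow> 1 / (1 + s) * (1 / (1 + s'))"
proof -
  \<comment> \<open>The factor \<open>\<eta>\<close> = - i writes the imaginary part of a power as the real part of its product with
    \<open>\<eta>\<close>, so that all four forms have the same shape.\<close>
  define v where "v i = (if i < 2 then cis t else cis u)" for i :: nat
  define \<eta> where "\<eta> i = (if even i then 1 else - \<i>)" for i :: nat
  define c where "c i = (if i < 2 then sqrt (2 * s) else sqrt (2 * s'))" for i :: nat
  define a where "a n i k = c i / sqrt n * Re (v i ^ k * \<eta> i)" for n i k :: nat
  define S where "S i = (if i < 2 then s else s')" for i :: nat
  have four: "{..<4} = {0, 1, 2, 3 :: nat}" by auto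
  have v1: "cmod (v i) = 1" for i by (simp add: v_def)
  have "(\<lambda>n. sign_mean n (\<lambda>x. exp (- (\<Sum>i<4. (\<Sum>k<n. a n i k * x k)\<^sup>2) / 2)))
    \<longlonglongrightarrow> (\<Prod>i<4. 1 / sqrt (1 + S i))"
  proof (rule sign_mean_exp_quadratic_tendsto)
    fix n i k :: nat assume "i < 4" "k < n"
    have "\<bar>Re (v i ^ k * \<eta> i)\<bar> \<le> 1"
      using abs_Re_le_cmod[of "v i ^ k * \<eta> i"] by (simp add: norm_mult norm_power v1 \<eta>_def split: if_splits)
    moreover have "\<bar>c i\<bar> \<le> sqrt (2 * s) + sqrt (2 * s')" using s by (auto simp: c_def)
    ultimately have "\<bar>c i\<bar> / sqrt n * \<bar>Re (v i ^ k * \<eta> i)\<bar> \<le> (sqrt (2 * s) + sqrt (2 * s')) / sqrt n * 1"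
      using s by (intro mult_mono divide_right_mono) auto
    then show "\<bar>a n i k\<bar> \<le> (sqrt (2 * s) + sqrt (2 * s')) / sqrt n"
      by (simp add: a_def abs_mult)
  next
    fix i j :: nat assume ij: "i < 4" "j < 4"
    have prod: "Re p * Re q = Re (p * q + p * cnj q) / 2" for p q by simp
    have "(\<Sum>k<n. a n i k * a n j k) = c i * c j / 2 * Re (((\<Sum>k<n. (v i * v j) ^ k) / n) * (\<eta> i * \<eta> j)
        + ((\<Sum>k<n. (v i * cnj (v j)) ^ k) / n) * (\<eta> i * cnj (\<eta> j)))" for n
    proof -
      have "a n i k * a n j k = c i * c j / 2 * (Re ((v i * v j) ^ k * (\<eta> i * \<eta> j)
        + (v i * cnj (v j)) ^ k * (\<eta> i * cnj (\<eta> j))) / n)" for k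
      proof -
        have "a n i k * a n j k = c i * c j / n * (Re (v i ^ k * \<eta> i) * Re (v j ^ k * \<eta> j))"
          by (simp add: a_def real_sqrt_mult_self mult_ac)
        also have "\<dots> = c i * c j / n * (Re ((v i * v j) ^ k * (\<eta> i * \<eta> j)
            + (v i * cnj (v j)) ^ k * (\<eta> i * cnj (\<eta> j))) / 2)"
          unfolding prod by (simp only: power_mult_distrib complex_cnj_mult complex_cnj_power mult_ac)
        finally show ?thesis by simp
      qed
      then have "(\<Sum>k<n. a n i k * a n j k) = c i * c j / 2 * ((\<Sum>k<n. Re ((v i * v j) ^ k * (\<eta> i * \<eta> j)
        + (v i * cnj (v j)) ^ k * (\<eta> i * cnj (\<eta> j)))) / n)"
        by (simp only: sum_distrib_left sum_divide_distrib)
      also have "(\<Sum>k<n. Re ((v i * v j) ^ k * (\<eta> i * \<eta> j)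
        + (v i * cnj (v j)) ^ k * (\<eta> i * cnj (\<eta> j))))
        = Re ((\<Sum>k<n. (v i * v j) ^ k) * (\<eta> i * \<eta> j) + (\<Sum>k<n. (v i * cnj (v j)) ^ k) * (\<eta> i * cnj (\<eta> j)))"
        by (simp only: Re_sum[symmetric] sum.distrib sum_distrib_right)
      also have "\<dots> / n = Re (((\<Sum>k<n. (v i * v j) ^ k) * (\<eta> i * \<eta> j) + (\<Sum>k<n. (v i * cnj (v j)) ^ k) * (\<eta> i * cnj (\<eta> j))) / n)"
        by (simp only: Re_divide_of_nat)
      finally show ?thesis by (simp only: add_divide_distrib times_divide_eq_left)
    qed
    moreover have "(\<lambda>n. c i * c j / 2 * Re (((\<Sum>k<n. (v i * v j) ^ k) / n) * (\<eta> i * \<eta> j)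
        + ((\<Sum>k<n. (v i * cnj (v j)) ^ k) / n) * (\<eta> i * cnj (\<eta> j))))
      \<longlonglongrightarrow> c i * c j / 2 * Re ((if v i * v j = 1 then 1 else 0) * (\<eta> i * \<eta> j)
          + (if v i * cnj (v j) = 1 then 1 else 0) * (\<eta> i * cnj (\<eta> j)))"
      by (intro tendsto_intros mean_power_tendsto) (simp_all add: norm_mult v1)
    moreover have "c i * c j / 2 * Re ((if v i * v j = 1 then 1 else 0) * (\<eta> i * \<eta> j)
          + (if v i * cnj (v j) = 1 then 1 else 0) * (\<eta> i * cnj (\<eta> j))) = (if i = j then S i else 0)"
    proof -
      have 1: "v i * v j \<noteq> 1"
        using assms by (auto simp: v_def power2_eq_square mult.commute)
      have 2: "v i * cnj (v j) = 1 \<longleftrightarrow> (i < 2 \<longleftrightarrow> j < 2)"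
      proof -
        have "v i * cnj (v j) = v i / v j"
          by (subst complex_div_cnj) (simp add: v1)
        then have "v i * cnj (v j) = 1 \<longleftrightarrow> v i = v j"
          using v1[of j] by auto
        then show ?thesis using assms by (auto simp: v_def)
      qed
      have 3: "i = j \<longleftrightarrow> (i < 2 \<longleftrightarrow> j < 2) \<and> (even i \<longleftrightarrow> even j)"
        using ij by presburger
      have 4: "Re (\<eta> i * cnj (\<eta> j)) = (if even i \<longleftrightarrow> even j then 1 else 0)"
        by (simp add: \<eta>_def)
      have 5: "c i * c i / 2 = S i"
        using s by (simp add: c_def S_def)
      show ?thesis
      proof (cases "i = j")
        case True
        then show ?thesis using 1 2 4 5 by simp
      next
        case False
        then show ?thesis using 1 2 3 4 by auto
      qed
    qed
    ultimately show "(\<lambda>n. \<Sum>k<n. a n i k * a n j k) \<longlonglongrightarrow> (if i = j then S i else 0)"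
      by (simp only:)
  qed (use s in \<open>auto simp: S_def\<close>)
  moreover have "(\<Prod>i<4. 1 / sqrt (1 + S i)) = 1 / (1 + s) * (1 / (1 + s'))"
    using s by (simp add: four S_def)
  moreover have "exp (- (\<Sum>i<4. (\<Sum>k<n. a n i k * x k)\<^sup>2) / 2)
      = exp (- (s * energy n x t)) * exp (- (s' * energy n x u))" for n and x :: "nat \<Rightarrow> real"
  proof -
    have lin: "(\<Sum>k<n. a n i k * x k) = c i / sqrt n * Re (walk n x (v i) * \<eta> i)" for i
      by (simp add: a_def walk_def sum_distrib_left sum_distrib_right sum_subtractf[symmetric] algebra_simps)
    have "(\<Sum>i<4. (\<Sum>k<n. a n i k * x k)\<^sup>2) = 2 * s * energy n x t + 2 * s' * energy n x u"
      unfolding lin using s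
      by (simp add: four c_def v_def \<eta>_def energy_def cmod_power2 power_mult_distrib power_divide add_divide_distrib distrib_left)
    moreover have "- (2 * s * E + 2 * s' * F) / 2 = - (s * E) + - (s' * F)" for E F
      by (simp add: field_simps)
    ultimately show ?thesis by (simp only: exp_add)
  qed
  ultimately show ?thesis by simp
qed

section \<open>Concentration of averages over the circle\<close>

definition laplace :: "nat \<Rightarrow> (nat \<Rightarrow> real) \<Rightarrow> real \<Rightarrow> real" where
  "laplace n x s = (\<integral>t. exp (- (s * energy n x t)) \<partial>circ)"

lemma integrable_exp_energy: "0 \<le> s \<Longrightarrow> integrable circ (\<lambda>t. exp (- (s * energy n x t)))"
  by (intro circ.integrable_const_bound[where B = 1]) (auto simp: energy_nonneg)

lemma AE_circ_generic:
  "AE t in circ. (cis t)\<^sup>2 \<noteq> 1 \<and> (AE u in circ. (cis u)\<^sup>2 \<noteq> 1 \<and> cis t * cis u \<noteq> 1 \<and> cis t \<noteq> cis u)"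
proof -
  have sq: "AE t in circ. (cis t)\<^sup>2 \<noteq> 1"
    using AE_circ_cis_neq[of 1] AE_circ_cis_neq[of "-1"] by eventually_elim (simp add: power2_eq_1_iff)
  have "AE u in circ. (cis u)\<^sup>2 \<noteq> 1 \<and> cis t * cis u \<noteq> 1 \<and> cis t \<noteq> cis u" for t
    using sq AE_circ_cis_neq[of "cis (- t)"] AE_circ_cis_neq[of "cis t"]
  proof eventually_elim
    case (elim u)
    have "cis u = cis (- t)" if "cis t * cis u = 1"
    proof -
      have "cis u = cis (- t) * (cis t * cis u)" by (simp add: mult.assoc[symmetric] cis_mult)
      then show ?thesis using that by simp
    qed
    then show ?case using elim by auto
  qed
  then show ?thesis using sq by simp
qed

text \<open>The product of two circle averages is a double average over pairs of points, almost all of which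
  are generic; the limit theorem for two points is integrated in two steps.\<close>

lemma laplace_product_tendsto:
  assumes s: "0 \<le> s" "0 \<le> s'"
  shows "(\<lambda>n. sign_mean n (\<lambda>x. laplace n x s * laplace n x s')) \<longlonglongrightarrow> 1 / (1 + s) * (1 / (1 + s'))"
proof -
  let ?L = "1 / (1 + s) * (1 / (1 + s'))"
  define G where "G n t = sign_mean n (\<lambda>x. exp (- (s * energy n x t)) * laplace n x s')" for n t
  have e1: "exp (- (s * energy n x t)) \<le> 1" "exp (- (s' * energy n x t)) \<le> 1" for n x t
    using s energy_nonneg[of n x t] by auto
  have lap: "0 \<le> laplace n x s'" "laplace n x s' \<le> 1" for n x
  proof -
    show "0 \<le> laplace n x s'" unfolding laplace_def by (rule Bochner_Integration.integral_nonneg) auto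
    have "laplace n x s' \<le> (\<integral>t. 1 \<partial>circ)"
      unfolding laplace_def by (intro integral_mono integrable_exp_energy s e1) auto
    then show "laplace n x s' \<le> 1" by simp
  qed
  have bound: "\<bar>sign_mean n f\<bar> \<le> 1" if "\<And>x. \<bar>f x\<bar> \<le> 1" for n f
    using order_trans[OF sign_mean_abs sign_mean_mono, of n f "\<lambda>_. 1"] that by simp
  have G: "(\<lambda>n. G n t) \<longlonglongrightarrow> ?L"
    if t: "(cis t)\<^sup>2 \<noteq> 1" and u: "AE u in circ. (cis u)\<^sup>2 \<noteq> 1 \<and> cis t * cis u \<noteq> 1 \<and> cis t \<noteq> cis u" for t
  proof -
    have "G n t = (\<integral>u. sign_mean n (\<lambda>x. exp (- (s * energy n x t)) * exp (- (s' * energy n x u))) \<partial>circ)" for n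
      unfolding G_def laplace_def
      by (subst sign_mean_integral) (auto intro!: integrable_mult_right integrable_exp_energy s)
    moreover have "(\<lambda>n. \<integral>u. sign_mean n (\<lambda>x. exp (- (s * energy n x t)) * exp (- (s' * energy n x u))) \<partial>circ)
        \<longlonglongrightarrow> (\<integral>u. ?L \<partial>circ)"
    proof (rule integral_dominated_convergence[where w = "\<lambda>_. 1"])
      show "AE u in circ. (\<lambda>n. sign_mean n (\<lambda>x. exp (- (s * energy n x t)) * exp (- (s' * energy n x u)))) \<longlonglongrightarrow> ?L"
        using u by eventually_elim (rule two_point_clt, use t s in auto)
      show "AE u in circ. norm (sign_mean n (\<lambda>x. exp (- (s * energy n x t)) * exp (- (s' * energy n x u)))) \<le> 1" for n
        using e1 by (intro AE_I2) (auto intro!: bound mult_le_one)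
      show "(\<lambda>u. sign_mean n (\<lambda>x. exp (- (s * energy n x t)) * exp (- (s' * energy n x u)))) \<in> borel_measurable circ" for n
        unfolding sign_mean_def by measurable
    qed auto
    ultimately show ?thesis by simp
  qed
  have "sign_mean n (\<lambda>x. laplace n x s * laplace n x s') = (\<integral>t. G n t \<partial>circ)" for n
    unfolding G_def laplace_def[of n _ s]
    by (subst sign_mean_integral) (auto intro!: integrable_mult_left integrable_exp_energy s)
  moreover have "(\<lambda>n. \<integral>t. G n t \<partial>circ) \<longlonglongrightarrow> (\<integral>t. ?L \<partial>circ)"
  proof (rule integral_dominated_convergence[where w = "\<lambda>_. 1"])
    show "AE t in circ. (\<lambda>n. G n t) \<longlonglongrightarrow> ?L"
      using AE_circ_generic by eventually_elim (rule G, auto)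
    show "AE t in circ. norm (G n t) \<le> 1" for n
      unfolding G_def using e1 lap by (intro AE_I2) (auto intro!: bound mult_le_one simp: abs_mult)
    show "G n \<in> borel_measurable circ" for n
      unfolding G_def sign_mean_def by measurable
  qed auto
  ultimately show ?thesis by simp
qed

lemma sign_mean_abs_le_sqrt: "sign_mean n (\<lambda>x. \<bar>f x\<bar>) \<le> sqrt (sign_mean n (\<lambda>x. (f x)\<^sup>2))"
proof -
  define m where "m = sign_mean n (\<lambda>x. \<bar>f x\<bar>)"
  have "0 \<le> sign_mean n (\<lambda>x. (\<bar>f x\<bar> - m)\<^sup>2)" by (rule sign_mean_nonneg) simp
  also have "\<dots> = sign_mean n (\<lambda>x. (f x)\<^sup>2 - 2 * m * \<bar>f x\<bar> + m\<^sup>2)"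
    by (rule sign_mean_cong) (simp add: power2_eq_square algebra_simps)
  also have "\<dots> = sign_mean n (\<lambda>x. (f x)\<^sup>2) - 2 * m * m + m\<^sup>2"
    by (simp only: sign_mean_add sign_mean_diff sign_mean_cmult sign_mean_const m_def)
  finally have "m\<^sup>2 \<le> sign_mean n (\<lambda>x. (f x)\<^sup>2)" by (simp add: power2_eq_square)
  then show ?thesis unfolding m_def by (rule real_le_rsqrt)
qed

text \<open>By the product formula, the first and second moments of the circle average converge to c and
  c^2, so its variance tends to zero. As \<open>laplace n x 0\<close> is one, the first moment is a special case
  of the product formula too.\<close>

lemma laplace_tendsto_L1:
  assumes s: "0 \<le> s"
  shows "(\<lambda>n. sign_mean n (\<lambda>x. \<bar>laplace n x s - 1 / (1 + s)\<bar>)) \<longlonglongrightarrow> 0"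
proof -
  define c where "c = 1 / (1 + s)"
  have one: "laplace n x 0 = 1" for n x by (simp add: laplace_def)
  have "(\<lambda>n. sign_mean n (\<lambda>x. laplace n x s * laplace n x s) - 2 * c * sign_mean n (\<lambda>x. laplace n x s * laplace n x 0) + c\<^sup>2)
      \<longlonglongrightarrow> c * c - 2 * c * (c * 1) + c\<^sup>2"
    using laplace_product_tendsto[OF s s] laplace_product_tendsto[OF s order_refl]
    by (intro tendsto_intros) (simp_all add: c_def)
  moreover have "sign_mean n (\<lambda>x. laplace n x s * laplace n x s) - 2 * c * sign_mean n (\<lambda>x. laplace n x s * laplace n x 0) + c\<^sup>2
      = sign_mean n (\<lambda>x. (laplace n x s - c)\<^sup>2)" for n
  proof -
    have "sign_mean n (\<lambda>x. (laplace n x s - c)\<^sup>2)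
        = sign_mean n (\<lambda>x. laplace n x s * laplace n x s - 2 * c * (laplace n x s * laplace n x 0) + c\<^sup>2)"
      by (rule sign_mean_cong) (simp add: one power2_eq_square algebra_simps)
    then show ?thesis
      by (simp only: sign_mean_add sign_mean_diff sign_mean_cmult sign_mean_const)
  qed
  ultimately have "(\<lambda>n. sign_mean n (\<lambda>x. (laplace n x s - c)\<^sup>2)) \<longlonglongrightarrow> 0"
    by (simp add: power2_eq_square)
  from tendsto_real_sqrt[OF this]
  have "(\<lambda>n. sqrt (sign_mean n (\<lambda>x. (laplace n x s - c)\<^sup>2))) \<longlonglongrightarrow> 0" by simp
  then show ?thesis
    unfolding c_def[symmetric]
    by (rule Lim_null_comparison[rotated, OF _ always_eventually])
       (auto intro!: sign_mean_abs_le_sqrt simp: sign_mean_nonneg)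
qed

section \<open>The exponential limit law\<close>

text \<open>The limit law of Y: the squared modulus of a standard complex Gaussian variable.\<close>

definition expo :: "real measure" where
  "expo = density lborel (exponential_density 1)"

lemma sets_expo [measurable_cong, simp]: "sets expo = sets borel"
  by (simp add: expo_def)

lemma space_expo [simp]: "space expo = UNIV"
  by (simp add: expo_def)

interpretation expo: prob_space expo
  unfolding expo_def by (rule prob_space_exponential_density) simp

lemma measure_expo_UNIV [simp]: "measure expo UNIV = 1"
  using expo.prob_space by simp

lemma exponential_density_1_nonneg: "0 \<le> exponential_density 1 y"
  by (simp add: exponential_density_def)

lemma AE_expo_pos: "AE y in expo. 0 < y"
proof -
  have "AE y in lborel. y \<noteq> (0::real)" by (rule AE_lborel_singleton)
  then show ?thesis
    unfolding expo_def
    by (subst AE_density) (auto simp: exponential_density_def elim!: eventually_mono)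
qed

lemma integral_expo_exp:
  assumes "0 \<le> s"
  shows "(\<integral>y. exp (- (s * y)) \<partial>expo) = 1 / (1 + s)"
proof -
  have one: "(\<integral>y. exponential_density (1 + s) y \<partial>lborel) = 1"
  proof -
    interpret P: prob_space "density lborel (exponential_density (1 + s))"
      by (rule prob_space_exponential_density) (use assms in simp)
    have "(\<integral>y. 1 \<partial>density lborel (exponential_density (1 + s))) = (1 :: real)"
      using P.prob_space by simp
    then show ?thesis
      by (subst (asm) integral_real_density) (use assms in \<open>auto simp: exponential_density_def\<close>)
  qed
  have "(\<integral>y. exp (- (s * y)) \<partial>expo) = (\<integral>y. exponential_density 1 y * exp (- (s * y)) \<partial>lborel)"
    unfolding expo_def by (rule integral_real_density) (auto simp: exponential_density_1_nonneg)
  also have "\<dots> = (\<integral>y. 1 / (1 + s) * exponential_density (1 + s) y \<partial>lborel)"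
  proof (intro Bochner_Integration.integral_cong refl)
    fix y
    have "exp (- y) * exp (- (s * y)) = exp (- y * (1 + s))"
      by (simp add: exp_add[symmetric] algebra_simps)
    then show "exponential_density 1 y * exp (- (s * y)) = 1 / (1 + s) * exponential_density (1 + s) y"
      using assms by (simp add: exponential_density_def)
  qed
  also have "\<dots> = 1 / (1 + s)" using one by simp
  finally show ?thesis .
qed

text \<open>The values exp (- Y) lie in the compact interval [0, 1], where h is uniformly close to a polynomial,
  and for a polynomial the claim is a finite combination of Laplace transforms at integers.\<close>

lemma circle_average_tendsto_L1:
  fixes h :: "real \<Rightarrow> real"
  assumes h: "continuous_on {0..1} h" and [measurable]: "h \<in> borel_measurable borel"
  shows "(\<lambda>n. sign_mean n (\<lambda>x. \<bar>(\<integral>t. h (exp (- energy n x t)) \<partial>circ) - (\<integral>y. h (exp (- y)) \<partial>expo)\<bar>)) \<longlonglongrightarrow> 0"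
proof (rule tendstoI)
  fix e :: real assume e: "0 < e"
  obtain p where p: "real_polynomial_function p" "\<And>u. u \<in> {0..1} \<Longrightarrow> \<bar>h u - p u\<bar> < e / 3"
    using Stone_Weierstrass_real_polynomial_function[OF compact_Icc h, of "e / 3"] e by auto
  then obtain c m where pc: "p = (\<lambda>u. \<Sum>i\<le>m. c i * u ^ i)"
    unfolding real_polynomial_function_iff_sum by blast
  have [measurable]: "p \<in> borel_measurable borel" unfolding pc by measurable
  have bd: "bounded (h ` {0..1})"
    by (intro compact_imp_bounded compact_continuous_image h compact_Icc)
  then obtain H where "\<forall>y\<in>h ` {0..1}. norm y \<le> H" unfolding bounded_iff by blast
  then have H: "\<bar>h u\<bar> \<le> H" if "u \<in> {0..1}" for u using that by auto
  have U: "exp (- energy n x t) \<in> {0..1}" for n x t using energy_nonneg[of n x t] by simp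
  have pH: "\<bar>p u\<bar> \<le> H + e" if "u \<in> {0..1}" for u
    using p(2)[OF that] H[OF that] e by linarith
  have V: "AE y in expo. exp (- y) \<in> {0..1}"
    using AE_expo_pos by eventually_elim simp
  have int_h: "integrable circ (\<lambda>t. h (exp (- energy n x t)))" for n x
    by (intro circ.integrable_const_bound[where B = H] AE_I2) (use H U in auto)
  have int_p: "integrable circ (\<lambda>t. p (exp (- energy n x t)))" for n x
    by (intro circ.integrable_const_bound[where B = "H + e"] AE_I2) (use pH U in auto)
  have int_h': "integrable expo (\<lambda>y. h (exp (- y)))"
    by (intro expo.integrable_const_bound[where B = H]) (use V H in \<open>auto elim!: eventually_mono\<close>)
  have int_p': "integrable expo (\<lambda>y. p (exp (- y)))"
    by (intro expo.integrable_const_bound[where B = "H + e"]) (use V pH in \<open>auto elim!: eventually_mono\<close>)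
  have circ_p: "(\<integral>t. p (exp (- energy n x t)) \<partial>circ) = (\<Sum>i\<le>m. c i * laplace n x i)" for n x
  proof -
    have "(\<integral>t. p (exp (- energy n x t)) \<partial>circ) = (\<integral>t. (\<Sum>i\<le>m. c i * exp (- (real i * energy n x t))) \<partial>circ)"
      by (simp add: pc exp_of_nat_mult[symmetric])
    then show ?thesis by (simp add: laplace_def integrable_exp_energy)
  qed
  have expo_p: "(\<integral>y. p (exp (- y)) \<partial>expo) = (\<Sum>i\<le>m. c i * (1 / (1 + real i)))"
  proof -
    have int: "integrable expo (\<lambda>y. exp (- (real i * y)))" for i
      by (intro expo.integrable_const_bound[where B = 1]) (use AE_expo_pos in \<open>auto elim!: eventually_mono\<close>)
    have "(\<integral>y. p (exp (- y)) \<partial>expo) = (\<integral>y. (\<Sum>i\<le>m. c i * exp (- (real i * y))) \<partial>expo)"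
      by (simp add: pc exp_of_nat_mult[symmetric])
    then show ?thesis by (simp add: int integral_expo_exp)
  qed
  have le: "\<bar>(\<integral>t. h (exp (- energy n x t)) \<partial>circ) - (\<integral>y. h (exp (- y)) \<partial>expo)\<bar>
      \<le> 2 * e / 3 + (\<Sum>i\<le>m. \<bar>c i\<bar> * \<bar>laplace n x i - 1 / (1 + real i)\<bar>)" for n x
  proof -
    have "\<bar>(\<integral>t. h (exp (- energy n x t)) \<partial>circ) - (\<integral>t. p (exp (- energy n x t)) \<partial>circ)\<bar>
        = \<bar>\<integral>t. h (exp (- energy n x t)) - p (exp (- energy n x t)) \<partial>circ\<bar>"
      using int_h int_p by simp
    also have "\<dots> \<le> (\<integral>t. \<bar>h (exp (- energy n x t)) - p (exp (- energy n x t))\<bar> \<partial>circ)"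
      by (rule integral_abs_bound)
    also have "\<dots> \<le> (\<integral>t. e / 3 \<partial>circ)"
      using p(2)[OF U] by (intro integral_mono integrable_abs Bochner_Integration.integrable_diff int_h int_p) (auto intro: less_imp_le)
    finally have 1: "\<bar>(\<integral>t. h (exp (- energy n x t)) \<partial>circ) - (\<Sum>i\<le>m. c i * laplace n x i)\<bar> \<le> e / 3"
      by (simp add: circ_p)
    have "\<bar>(\<integral>y. h (exp (- y)) \<partial>expo) - (\<integral>y. p (exp (- y)) \<partial>expo)\<bar> = \<bar>\<integral>y. h (exp (- y)) - p (exp (- y)) \<partial>expo\<bar>"
      using int_h' int_p' by simp
    also have "\<dots> \<le> (\<integral>y. \<bar>h (exp (- y)) - p (exp (- y))\<bar> \<partial>expo)"
      by (rule integral_abs_bound)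
    also have "\<dots> \<le> (\<integral>y. e / 3 \<partial>expo)"
    proof (intro integral_mono_AE integrable_abs Bochner_Integration.integrable_diff int_h' int_p')
      show "AE y in expo. \<bar>h (exp (- y)) - p (exp (- y))\<bar> \<le> e / 3"
        using V by eventually_elim (use p(2) in \<open>auto intro: less_imp_le\<close>)
    qed simp
    finally have 2: "\<bar>(\<integral>y. h (exp (- y)) \<partial>expo) - (\<Sum>i\<le>m. c i * (1 / (1 + real i)))\<bar> \<le> e / 3"
      by (simp add: expo_p)
    have "\<bar>(\<Sum>i\<le>m. c i * laplace n x i) - (\<Sum>i\<le>m. c i * (1 / (1 + real i)))\<bar>
        = \<bar>\<Sum>i\<le>m. c i * (laplace n x i - 1 / (1 + real i))\<bar>"
      by (simp add: sum_subtractf right_diff_distrib)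
    also have "\<dots> \<le> (\<Sum>i\<le>m. \<bar>c i * (laplace n x i - 1 / (1 + real i))\<bar>)" by (rule sum_abs)
    finally have 3: "\<bar>(\<Sum>i\<le>m. c i * laplace n x i) - (\<Sum>i\<le>m. c i * (1 / (1 + real i)))\<bar>
        \<le> (\<Sum>i\<le>m. \<bar>c i\<bar> * \<bar>laplace n x i - 1 / (1 + real i)\<bar>)" by (simp add: abs_mult)
    show ?thesis using 1 2 3 by linarith
  qed
  have "(\<lambda>n. \<Sum>i\<le>m. \<bar>c i\<bar> * sign_mean n (\<lambda>x. \<bar>laplace n x i - 1 / (1 + real i)\<bar>)) \<longlonglongrightarrow> (\<Sum>i\<le>m. \<bar>c i\<bar> * 0)"
    by (intro tendsto_sum tendsto_mult tendsto_const laplace_tendsto_L1) simp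
  then have "\<forall>\<^sub>F n in sequentially. (\<Sum>i\<le>m. \<bar>c i\<bar> * sign_mean n (\<lambda>x. \<bar>laplace n x i - 1 / (1 + real i)\<bar>)) < e / 3"
    using e by (intro order_tendstoD(2)) auto
  then show "\<forall>\<^sub>F n in sequentially. dist (sign_mean n (\<lambda>x. \<bar>(\<integral>t. h (exp (- energy n x t)) \<partial>circ) - (\<integral>y. h (exp (- y)) \<partial>expo)\<bar>)) 0 < e"
  proof eventually_elim
    case (elim n)
    have "sign_mean n (\<lambda>x. \<bar>(\<integral>t. h (exp (- energy n x t)) \<partial>circ) - (\<integral>y. h (exp (- y)) \<partial>expo)\<bar>)
        \<le> sign_mean n (\<lambda>x. 2 * e / 3 + (\<Sum>i\<le>m. \<bar>c i\<bar> * \<bar>laplace n x i - 1 / (1 + real i)\<bar>))"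
      by (rule sign_mean_mono) (rule le)
    also have "\<dots> = 2 * e / 3 + (\<Sum>i\<le>m. \<bar>c i\<bar> * sign_mean n (\<lambda>x. \<bar>laplace n x i - 1 / (1 + real i)\<bar>))"
      by (simp only: sign_mean_add sign_mean_const sign_mean_sum sign_mean_cmult)
    also have "\<dots> < e" using elim by simp
    finally show ?case by (simp add: sign_mean_nonneg)
  qed
qed

section \<open>The logarithmic moment of the exponential law\<close>

lemma integral_expo_powr:
  assumes "-1 < h"
  shows "integrable expo (\<lambda>y. y powr h)" and "(\<integral>y. y powr h \<partial>expo) = Gamma (1 + h)"
proof -
  have "(\<integral>\<^sup>+y. ennreal (y powr h) \<partial>expo) = (\<integral>\<^sup>+y. ennreal (exponential_density 1 y) * ennreal (y powr h) \<partial>lborel)"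
    unfolding expo_def by (rule nn_integral_density) auto
  also have "\<dots> = (\<integral>\<^sup>+y. ennreal (indicator {0..} y * y powr ((1 + h) - 1) / exp y) \<partial>lborel)"
    by (intro nn_integral_cong)
       (auto simp: exponential_density_def indicator_def ennreal_mult'[symmetric] exp_minus field_simps)
  also have "\<dots> = ennreal (Gamma (1 + h))"
    using Gamma_conv_nn_integral_real[of "1 + h"] assms by simp
  finally have "has_bochner_integral expo (\<lambda>y. y powr h) (Gamma (1 + h))"
    using assms by (intro has_bochner_integral_nn_integral) (auto intro!: less_imp_le Gamma_real_pos)
  then show "integrable expo (\<lambda>y. y powr h)" "(\<integral>y. y powr h \<partial>expo) = Gamma (1 + h)"
    by (auto simp: has_bochner_integral_iff)
qed

lemma ln_powr_bounds:
  fixes y h :: real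
  assumes "0 < y" "0 < h"
  shows "(1 - y powr (- h)) / h \<le> ln y" and "ln y \<le> (y powr h - 1) / h"
proof -
  have *: "k * ln y \<le> y powr k - 1" for k
    using ln_le_minus_one[of "y powr k"] assms by (simp add: ln_powr)
  show "ln y \<le> (y powr h - 1) / h" using *[of h] assms by (simp add: field_simps)
  show "(1 - y powr (- h)) / h \<le> ln y" using *[of "- h"] assms by (simp add: field_simps)
qed

lemma integrable_expo_ln: "integrable expo ln"
proof (rule Bochner_Integration.integrable_bound)
  show "integrable expo (\<lambda>y::real. 2 * (y powr (1/2) + y powr (-1/2)))"
    by (intro integrable_mult_right Bochner_Integration.integrable_add integral_expo_powr) auto
  show "AE y in expo. norm (ln y) \<le> norm (2 * (y powr (1/2) + y powr (-1/2)))"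
    using AE_expo_pos
  proof eventually_elim
    case (elim y)
    then have "(1 - y powr (- (1/2))) / (1/2) \<le> ln y" "ln y \<le> (y powr (1/2) - 1) / (1/2)"
      by (intro ln_powr_bounds; simp)+
    moreover have "\<bar>L\<bar> \<le> 2 * (A + B)"
      if "(1 - B) / (1/2) \<le> L" "L \<le> (A - 1) / (1/2)" "0 \<le> A" "0 \<le> B" for L A B :: real
      using that by (auto simp: abs_le_iff)
    ultimately have "\<bar>ln y\<bar> \<le> 2 * (y powr (1/2) + y powr (- (1/2)))"
      by (metis powr_ge_zero)
    then show ?case by simp
  qed
qed simp

text \<open>This is Gamma'(1). Instead of differentiating under the integral sign, the logarithm is
  enclosed between difference quotients of y^h at h = 0, whose integrals are difference quotients of
  Gamma at 1.\<close>

lemma integral_expo_ln: "(\<integral>y. ln y \<partial>expo) = - euler_mascheroni"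
proof -
  let ?D = "\<lambda>h. (Gamma (1 + h) - Gamma 1) / h :: real"
  let ?I = "\<integral>y. ln y \<partial>expo"
  have "(Gamma has_field_derivative Gamma 1 * Digamma 1) (at (1::real))"
    by (rule has_field_derivative_Gamma) simp
  then have D: "(?D \<longlongrightarrow> - euler_mascheroni) (at 0)" by (simp add: DERIV_def)
  have up: "?I \<le> ?D h" if "0 < h" for h
  proof -
    have int: "integrable expo (\<lambda>y. (y powr h - 1) / h)"
      using that by (intro integrable_divide_zero Bochner_Integration.integrable_diff integral_expo_powr) auto
    have "?I \<le> (\<integral>y. (y powr h - 1) / h \<partial>expo)"
    proof (rule integral_mono_AE[OF integrable_expo_ln int])
      show "AE y in expo. ln y \<le> (y powr h - 1) / h"
        using AE_expo_pos by eventually_elim (rule ln_powr_bounds(2)[OF _ that])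
    qed
    also have "\<dots> = ?D h" using that by (simp add: integral_expo_powr)
    finally show ?thesis .
  qed
  have low: "?D (- h) \<le> ?I" if "0 < h" "h < 1" for h
  proof -
    have int: "integrable expo (\<lambda>y. (1 - y powr (- h)) / h)"
      using that by (intro integrable_divide_zero Bochner_Integration.integrable_diff integral_expo_powr) auto
    have "(\<integral>y. (1 - y powr (- h)) / h \<partial>expo) \<le> ?I"
    proof (rule integral_mono_AE[OF int integrable_expo_ln])
      show "AE y in expo. (1 - y powr (- h)) / h \<le> ln y"
        using AE_expo_pos by eventually_elim (rule ln_powr_bounds(1)[OF _ that(1)])
    qed
    also have "(\<integral>y. (1 - y powr (- h)) / h \<partial>expo) = (1 - Gamma (1 + - h)) / h"
      using that integral_expo_powr[of "- h"] by simp
    also have "\<dots> = ?D (- h)" using that by (simp add: field_simps)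
    finally show ?thesis .
  qed
  have R: "(?D \<longlongrightarrow> - euler_mascheroni) (at_right 0)"
    using D by (rule tendsto_within_subset) simp
  have "filterlim (\<lambda>h::real. - h) (at 0) (at_right 0)"
    unfolding filterlim_at by (auto intro!: tendsto_eq_intros simp: eventually_at_filter)
  with D have L: "((\<lambda>h. ?D (- h)) \<longlongrightarrow> - euler_mascheroni) (at_right 0)"
    by (rule filterlim_compose)
  have ev: "\<forall>\<^sub>F h in at_right (0::real). 0 < h \<and> h < 1"
    using eventually_at_right_real[of 0 1] by (auto elim: eventually_mono)
  have "?I \<le> - euler_mascheroni"
    by (rule tendsto_lowerbound[OF R]) (use ev up in \<open>auto elim: eventually_mono\<close>)
  moreover have "- euler_mascheroni \<le> ?I"
    by (rule tendsto_upperbound[OF L]) (use ev low in \<open>auto elim: eventually_mono\<close>)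
  ultimately show ?thesis by simp
qed

definition clamp_ln :: "real \<Rightarrow> real \<Rightarrow> real \<Rightarrow> real" where
  "clamp_ln d K y = ln (max d (min K y))"

lemma clamp_ln_tendsto:
  "(\<lambda>m. \<integral>y. clamp_ln (1 / real (Suc m)) (real (Suc m)) y \<partial>expo) \<longlonglongrightarrow> - euler_mascheroni"
  unfolding integral_expo_ln[symmetric]
proof (rule integral_dominated_convergence[where w = "\<lambda>y. \<bar>ln y\<bar>"])
  show "integrable expo (\<lambda>y. \<bar>ln y\<bar>)" by (intro integrable_abs integrable_expo_ln)
  show "AE y in expo. (\<lambda>m. clamp_ln (1 / real (Suc m)) (real (Suc m)) y) \<longlonglongrightarrow> ln y"
    using AE_expo_pos
  proof eventually_elim
    case (elim y)
    have "(\<lambda>m. 1 / real (Suc m)) \<longlonglongrightarrow> 0" using LIMSEQ_inverse_real_of_nat by (simp add: inverse_eq_divide)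
    then have "\<forall>\<^sub>F m in sequentially. 1 / real (Suc m) < y" using elim by (rule order_tendstoD)
    moreover have "\<forall>\<^sub>F m in sequentially. y < real (Suc m)"
      using eventually_gt_at_top[of "nat \<lceil>y\<rceil>"] by eventually_elim linarith
    ultimately have "\<forall>\<^sub>F m in sequentially. clamp_ln (1 / real (Suc m)) (real (Suc m)) y = ln y"
      by eventually_elim (simp add: clamp_ln_def)
    then show ?case by (rule tendsto_eventually)
  qed
  show "AE y in expo. norm (clamp_ln (1 / real (Suc m)) (real (Suc m)) y) \<le> \<bar>ln y\<bar>" for m
    using AE_expo_pos
  proof eventually_elim
    case (elim y)
    have a: "0 < 1 / real (Suc m)" "1 / real (Suc m) \<le> 1" "1 \<le> real (Suc m)" by auto
    show ?case
    proof (cases "y \<le> 1")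
      case True
      then have "y \<le> max (1 / real (Suc m)) (min (real (Suc m)) y)" "max (1 / real (Suc m)) (min (real (Suc m)) y) \<le> 1"
        using a by auto
      moreover from this have "ln y \<le> clamp_ln (1 / real (Suc m)) (real (Suc m)) y" "clamp_ln (1 / real (Suc m)) (real (Suc m)) y \<le> ln 1"
        unfolding clamp_ln_def using elim by (auto intro!: ln_mono simp del: ln_one)
      ultimately show ?thesis by simp
    next
      case False
      then have "max (1 / real (Suc m)) (min (real (Suc m)) y) \<le> y" "1 \<le> max (1 / real (Suc m)) (min (real (Suc m)) y)"
        using a by linarith+
      then have "clamp_ln (1 / real (Suc m)) (real (Suc m)) y \<le> ln y" "ln 1 \<le> clamp_ln (1 / real (Suc m)) (real (Suc m)) y"
        unfolding clamp_ln_def using elim by (auto intro!: ln_mono simp del: ln_one)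
      then show ?thesis by simp
    qed
  qed
qed (simp_all add: clamp_ln_def[abs_def])

section \<open>Convergence of the mean logarithm\<close>

definition log_mean :: "nat \<Rightarrow> (nat \<Rightarrow> real) \<Rightarrow> real" where
  "log_mean n x = (\<integral>t. ln (energy n x t) \<partial>circ)"

lemma AE_energy_pos:
  assumes "x \<in> signs n" "0 < n"
  shows "AE t in circ. 0 < energy n x t"
proof -
  obtain r where r: "\<And>z. cmod (walk n x z) = (\<Prod>i<n - 1. cmod (z - r i))"
    using walk_roots[OF assms] by blast
  have "AE t in circ. \<forall>i\<in>{..<n - 1}. cis t \<noteq> r i"
    by (intro AE_finite_allI AE_circ_cis_neq) auto
  then show ?thesis
  proof eventually_elim
    case (elim t)
    then have "0 < cmod (walk n x (cis t))" unfolding r by (intro prod_pos) auto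
    then show ?case using assms by (simp add: energy_def)
  qed
qed

lemma integrable_energy: "integrable circ (energy n x)"
proof (intro circ.integrable_const_bound[where B = "(\<Sum>k<n. \<bar>x k\<bar>)\<^sup>2 / n"] AE_I2)
  fix t
  have "cmod (walk n x (cis t)) \<le> (\<Sum>k<n. \<bar>x k\<bar>)"
    unfolding walk_def by (rule order_trans[OF norm_sum]) (simp add: norm_mult norm_power)
  then have "(cmod (walk n x (cis t)))\<^sup>2 \<le> (\<Sum>k<n. \<bar>x k\<bar>)\<^sup>2" by (intro power_mono) auto
  then show "norm (energy n x t) \<le> (\<Sum>k<n. \<bar>x k\<bar>)\<^sup>2 / n"
    by (simp add: energy_def divide_right_mono)
qed simp

text \<open>The walk gains one in mean square with every step, by the parallelogram law.\<close>

lemma sign_mean_energy: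
  assumes "0 < n"
  shows "sign_mean n (\<lambda>x. \<integral>t. energy n x t \<partial>circ) = 1"
proof -
  have sq: "sign_mean n (\<lambda>x. (cmod (walk n x z))\<^sup>2) = n" if "cmod z = 1" for z n
  proof (induction n)
    case (Suc n)
    have upd: "walk (Suc n) (x(n := e)) z = walk n x z + of_real e * z ^ n" for x e
    proof -
      have "(\<Sum>k<n. of_real ((x(n := e)) k) * z ^ k) = walk n x z"
        unfolding walk_def by (intro sum.cong) auto
      then show ?thesis unfolding walk_def by simp
    qed
    have par: "(cmod (a + b))\<^sup>2 + (cmod (a - b))\<^sup>2 = 2 * (cmod a)\<^sup>2 + 2 * (cmod b)\<^sup>2" for a b
      unfolding cmod_power2 by (simp add: power2_eq_square algebra_simps)
    have "sign_mean (Suc n) (\<lambda>x. (cmod (walk (Suc n) x z))\<^sup>2)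
        = sign_mean n (\<lambda>x. (cmod (walk n x z + z ^ n))\<^sup>2 + (cmod (walk n x z - z ^ n))\<^sup>2) / 2"
      by (simp add: sign_mean_Suc upd sign_mean_add)
    also have "\<dots> = sign_mean n (\<lambda>x. 2 * (cmod (walk n x z))\<^sup>2 + 2) / 2"
      using that by (simp add: par norm_power)
    also have "\<dots> = Suc n"
      using Suc.IH by (simp add: sign_mean_add sign_mean_cmult)
    finally show ?case .
  qed (simp add: walk_def)
  have "sign_mean n (\<lambda>x. \<integral>t. energy n x t \<partial>circ) = (\<integral>t. sign_mean n (\<lambda>x. energy n x t) \<partial>circ)"
    by (rule sign_mean_integral[symmetric]) (rule integrable_energy)
  also have "\<dots> = (\<integral>t. 1 \<partial>circ)"
    using assms by (simp add: energy_def sign_mean_divide sq)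
  finally show ?thesis by simp
qed

lemma integrable_ln_energy:
  assumes x: "x \<in> signs n" and n: "6 \<le> n"
  shows "integrable circ (\<lambda>t. ln (energy n x t))"
proof (rule Bochner_Integration.integrable_bound)
  show "integrable circ (\<lambda>t. max 0 (ln (1 / energy n x t)) + energy n x t)"
    by (intro Bochner_Integration.integrable_add lower_tail(1) integrable_energy assms) auto
  show "AE t in circ. norm (ln (energy n x t)) \<le> norm (max 0 (ln (1 / energy n x t)) + energy n x t)"
  proof -
    have "AE t in circ. 0 < energy n x t" using n by (intro AE_energy_pos x) simp
    then show ?thesis
    proof eventually_elim
      case (elim t)
      then show ?case using ln_bound[OF elim] by (simp add: ln_div)
    qed
  qed
qed simp

lemma clamp_ln_error:
  assumes "0 < d" "d \<le> 1" "1 \<le> K" "0 < y"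
  shows "\<bar>ln y - clamp_ln d K y\<bar> \<le> max 0 (ln (d / y)) + y / K"
proof -
  have yK: "0 \<le> y / K" using assms by simp
  consider "y < d" | "d \<le> y" "y \<le> K" | "K < y" by linarith
  then show ?thesis
  proof cases
    case 1
    then have "clamp_ln d K y = ln d" "ln y < ln d" using assms by (auto simp: clamp_ln_def)
    then show ?thesis using assms yK by (simp add: ln_div)
  next
    case 2
    then have "clamp_ln d K y = ln y" by (simp add: clamp_ln_def)
    then show ?thesis using yK by simp
  next
    case 3
    then have "clamp_ln d K y = ln K" "ln K < ln y" using assms by (auto simp: clamp_ln_def)
    moreover have "ln (y / K) \<le> y / K" using assms by (intro ln_bound) auto
    ultimately show ?thesis using assms by (simp add: ln_div)
  qed
qed

text \<open>The four error terms come from the lower tail, the upper tail, the fluctuation of the truncated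
  average around its limit, and the truncation of the limit. With d and K fixed, everything that
  depends on n tends to zero; the rest is made small by the choice of d and K.\<close>

lemma log_mean_error:
  assumes n: "6 \<le> n" and d: "0 < d" "d \<le> 1" and K: "1 \<le> K"
  shows "sign_mean n (\<lambda>x. \<bar>log_mean n x + euler_mascheroni\<bar>)
    \<le> 12 * sqrt d + ((504 * ln n + 8) / sqrt n + 40 / n) + 1 / K
      + sign_mean n (\<lambda>x. \<bar>(\<integral>t. clamp_ln d K (energy n x t) \<partial>circ) - (\<integral>y. clamp_ln d K y \<partial>expo)\<bar>)
      + \<bar>(\<integral>y. clamp_ln d K y \<partial>expo) + euler_mascheroni\<bar>"
proof -
  let ?T = "\<integral>y. clamp_ln d K y \<partial>expo"
  let ?C = "\<lambda>x. \<integral>t. clamp_ln d K (energy n x t) \<partial>circ"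
  let ?W = "\<lambda>x. \<integral>t. max 0 (ln (d / energy n x t)) \<partial>circ"
  have int_c: "integrable circ (\<lambda>t. clamp_ln d K (energy n x t))" for x
  proof (intro circ.integrable_const_bound[where B = "\<bar>ln d\<bar> + \<bar>ln K\<bar>"] AE_I2)
    fix t
    have "d \<le> max d (min K (energy n x t))" "max d (min K (energy n x t)) \<le> K" using d K by auto
    then have "ln d \<le> clamp_ln d K (energy n x t)" "clamp_ln d K (energy n x t) \<le> ln K"
      unfolding clamp_ln_def using d by (auto intro!: ln_mono simp del: max.bounded_iff)
    then show "norm (clamp_ln d K (energy n x t)) \<le> \<bar>ln d\<bar> + \<bar>ln K\<bar>" by auto
  qed (simp add: clamp_ln_def)
  have main: "\<bar>log_mean n x - ?C x\<bar> \<le> ?W x + (\<integral>t. energy n x t \<partial>circ) / K" if x: "x \<in> signs n" for x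
  proof -
    have "\<bar>log_mean n x - ?C x\<bar> = \<bar>\<integral>t. ln (energy n x t) - clamp_ln d K (energy n x t) \<partial>circ\<bar>"
      using integrable_ln_energy[OF x n] int_c by (simp add: log_mean_def)
    also have "\<dots> \<le> (\<integral>t. \<bar>ln (energy n x t) - clamp_ln d K (energy n x t)\<bar> \<partial>circ)"
      by (rule integral_abs_bound)
    also have "\<dots> \<le> (\<integral>t. max 0 (ln (d / energy n x t)) + energy n x t / K \<partial>circ)"
    proof (rule integral_mono_AE)
      have "AE t in circ. 0 < energy n x t" using n by (intro AE_energy_pos x) simp
      then show "AE t in circ. \<bar>ln (energy n x t) - clamp_ln d K (energy n x t)\<bar> \<le> max 0 (ln (d / energy n x t)) + energy n x t / K"
        by eventually_elim (rule clamp_ln_error[OF d K])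
      show "integrable circ (\<lambda>t. max 0 (ln (d / energy n x t)) + energy n x t / K)"
        by (intro Bochner_Integration.integrable_add lower_tail(1) integrable_divide_zero integrable_energy n d x)
    qed (intro integrable_abs Bochner_Integration.integrable_diff integrable_ln_energy int_c x n)
    also have "\<dots> = ?W x + (\<integral>t. energy n x t \<partial>circ) / K"
      using lower_tail(1)[OF n d x] integrable_energy[of n x] by simp
    finally show ?thesis .
  qed
  have "sign_mean n (\<lambda>x. \<bar>log_mean n x + euler_mascheroni\<bar>)
    \<le> sign_mean n (\<lambda>x. ?W x + (\<integral>t. energy n x t \<partial>circ) / K + \<bar>?C x - ?T\<bar> + \<bar>?T + euler_mascheroni\<bar>)"
  proof (rule sign_mean_mono)
    fix x assume "x \<in> signs n"
    from main[OF this] show "\<bar>log_mean n x + euler_mascheroni\<bar>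
        \<le> ?W x + (\<integral>t. energy n x t \<partial>circ) / K + \<bar>?C x - ?T\<bar> + \<bar>?T + euler_mascheroni\<bar>"
      by linarith
  qed
  also have "\<dots> = sign_mean n ?W + 1 / K + sign_mean n (\<lambda>x. \<bar>?C x - ?T\<bar>) + \<bar>?T + euler_mascheroni\<bar>"
    using n by (simp add: sign_mean_add sign_mean_divide sign_mean_energy)
  finally show ?thesis using lower_tail(2)[OF n d] by linarith
qed

lemma log_mean_tendsto_L1:
  "(\<lambda>n. sign_mean n (\<lambda>x. \<bar>log_mean n x + euler_mascheroni\<bar>)) \<longlonglongrightarrow> 0"
proof (rule tendstoI)
  fix e :: real assume e: "0 < e"
  define T where "T m = (\<integral>y. clamp_ln (1 / real (Suc m)) (real (Suc m)) y \<partial>expo)" for m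
  have "(\<lambda>m. 12 * sqrt (1 / real (Suc m)) + 1 / real (Suc m) + \<bar>T m + euler_mascheroni\<bar>) \<longlonglongrightarrow> 12 * 0 + 0 + \<bar>- euler_mascheroni + euler_mascheroni\<bar>"
  proof (intro tendsto_intros)
    show "(\<lambda>m. sqrt (1 / real (Suc m))) \<longlonglongrightarrow> 0" "(\<lambda>m. 1 / real (Suc m)) \<longlonglongrightarrow> 0" by real_asymp+
    show "T \<longlonglongrightarrow> - euler_mascheroni" unfolding T_def by (rule clamp_ln_tendsto)
  qed
  then have "\<forall>\<^sub>F m in sequentially. 12 * sqrt (1 / real (Suc m)) + 1 / real (Suc m) + \<bar>T m + euler_mascheroni\<bar> < e / 2"
    using e by (intro order_tendstoD(2)) auto
  then obtain m where m: "12 * sqrt (1 / real (Suc m)) + 1 / real (Suc m) + \<bar>T m + euler_mascheroni\<bar> < e / 2"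
    by (auto simp: eventually_sequentially)
  define d K where "d = 1 / real (Suc m)" and "K = real (Suc m)"
  have d: "0 < d" "d \<le> 1" and K: "1 \<le> K" by (auto simp: d_def K_def)
  define D where "D n = sign_mean n (\<lambda>x. \<bar>(\<integral>t. clamp_ln d K (energy n x t) \<partial>circ) - (\<integral>y. clamp_ln d K y \<partial>expo)\<bar>)" for n
  have "D \<longlonglongrightarrow> 0"
  proof -
    \<comment> \<open>In terms of the variable u = exp (- y) the truncated logarithm is continuous up to u = 0.\<close>
    define h where "h u = ln (max d (- ln (max u (exp (- K)))))" for u
    have h_eq: "h (exp (- y)) = clamp_ln d K y" for y
    proof -
      have "max (exp (- y)) (exp (- K)) = exp (- min K y)" by (auto simp: max_def min_def)
      then show ?thesis by (simp add: h_def clamp_ln_def)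
    qed
    have pos: "0 < max u (exp (- K))" "0 < max d v" for u v using d by (auto simp: less_max_iff_disj)
    have "continuous_on {0..1} h"
      unfolding h_def
    proof (intro continuous_intros ballI)
      show "max u (exp (- K)) \<noteq> 0" "max d (- ln (max u (exp (- K)))) \<noteq> 0" for u
        using pos by (metis less_irrefl)+
    qed
    moreover have "h \<in> borel_measurable borel" unfolding h_def by measurable
    ultimately show ?thesis
      using circle_average_tendsto_L1[of h] by (simp add: h_eq D_def[abs_def])
  qed
  moreover have "(\<lambda>n. (504 * ln (real n) + 8) / sqrt (real n) + 40 / real n) \<longlonglongrightarrow> 0" by real_asymp
  ultimately have "(\<lambda>n. ((504 * ln (real n) + 8) / sqrt (real n) + 40 / real n) + D n) \<longlonglongrightarrow> 0 + 0"
    by (intro tendsto_add)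
  then have "\<forall>\<^sub>F n in sequentially. ((504 * ln (real n) + 8) / sqrt (real n) + 40 / real n) + D n < e / 2"
    using e by (intro order_tendstoD(2)) auto
  then show "\<forall>\<^sub>F n in sequentially. dist (sign_mean n (\<lambda>x. \<bar>log_mean n x + euler_mascheroni\<bar>)) 0 < e"
    using eventually_ge_at_top[of 6]
  proof eventually_elim
    case (elim n)
    have "12 * sqrt d + 1 / K + \<bar>(\<integral>y. clamp_ln d K y \<partial>expo) + euler_mascheroni\<bar> < e / 2"
      using m unfolding T_def d_def K_def .
    then have "sign_mean n (\<lambda>x. \<bar>log_mean n x + euler_mascheroni\<bar>) < e"
      using log_mean_error[OF elim(2) d K] elim(1) unfolding D_def by linarith
    then show ?case by (simp add: sign_mean_nonneg)
  qed
qed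

section \<open>From the model to random polynomials\<close>

lemma poly_random_poly:
  assumes "\<And>k. k < n \<Longrightarrow> X k \<omega> = x k"
  shows "poly (random_poly n X \<omega>) z = walk n x z"
  unfolding random_poly_def walk_def poly_sum poly_monom using assms by (intro sum.cong) auto

lemma mahler_measure_random_poly:
  assumes X: "\<And>k. k < n \<Longrightarrow> X k \<omega> = x k" and x: "x \<in> signs n" and n: "6 \<le> n"
  shows "mahler_measure (random_poly n X \<omega>) / sqrt n = exp (log_mean n x / 2)"
proof -
  let ?p = "random_poly n X \<omega>"
  have p: "poly ?p z = walk n x z" for z using X by (rule poly_random_poly)
  have pos: "AE t in circ. 0 < energy n x t" using n by (intro AE_energy_pos x) simp
  have "?p \<noteq> 0"
  proof
    assume "?p = 0"
    then have "energy n x t = 0" for t using p by (simp add: energy_def flip: p)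
    then have "AE t in circ. False" using pos by simp
    then show False using circ.AE_False by simp
  qed
  have meas: "(\<lambda>t. ln (cmod (poly ?p (cis t)))) \<in> borel_measurable borel"
    unfolding p walk_def by measurable
  have "(LBINT t:{-pi..pi}. ln (cmod (poly ?p (cis t)))) / (2 * pi) = (\<integral>t. ln (cmod (poly ?p (cis t))) \<partial>circ)"
    by (rule integral_circ[OF meas, symmetric])
  also have "\<dots> = (\<integral>t. (ln (energy n x t) + ln n) / 2 \<partial>circ)"
  proof (rule integral_cong_AE)
    show "AE t in circ. ln (cmod (poly ?p (cis t))) = (ln (energy n x t) + ln n) / 2"
      using pos
    proof eventually_elim
      case (elim t)
      then have "0 < cmod (walk n x (cis t))" by (auto simp: energy_def)
      then show ?case using n by (simp add: p energy_def ln_div ln_realpow)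
    qed
  qed (use meas in auto)
  also have "\<dots> = (log_mean n x + ln n) / 2"
    using integrable_ln_energy[OF x n] by (simp add: log_mean_def)
  finally have "mahler_measure ?p = exp (log_mean n x / 2 + ln n / 2)"
    using \<open>?p \<noteq> 0\<close> by (simp add: mahler_measure_def add_divide_distrib)
  also have "exp (ln n / 2) = sqrt n"
  proof -
    have "ln n / 2 = ln (sqrt n)" using n by (simp add: ln_sqrt)
    then show ?thesis using n by simp
  qed
  then have "exp (log_mean n x / 2 + ln n / 2) = exp (log_mean n x / 2) * sqrt n" by (simp add: exp_add)
  finally show ?thesis using n by simp
qed

lemma measurable_mahler_measure:
  assumes [measurable]: "\<And>k. k < n \<Longrightarrow> X k \<in> borel_measurable M"
  shows "(\<lambda>\<omega>. mahler_measure (random_poly n X \<omega>)) \<in> borel_measurable M"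
proof -
  have zero: "random_poly n X \<omega> = 0 \<longleftrightarrow> (\<forall>k\<in>{..<n}. X k \<omega> = 0)" for \<omega>
  proof
    assume 0: "random_poly n X \<omega> = 0"
    have "coeff (random_poly n X \<omega>) k = (if k < n then of_real (X k \<omega>) else 0)" for k
      by (simp add: random_poly_def coeff_sum if_distrib cong: if_cong)
    then show "\<forall>k\<in>{..<n}. X k \<omega> = 0"
      unfolding 0 by (metis coeff_0 lessThan_iff of_real_eq_0_iff)
  qed (simp add: random_poly_def)
  have [measurable]: "(\<lambda>\<omega>. LBINT \<theta>:{-pi..pi}. ln (cmod (poly (random_poly n X \<omega>) (cis \<theta>)))) \<in> borel_measurable M"
    unfolding set_lebesgue_integral_def poly_random_poly[OF refl] walk_def by measurable
  show ?thesis
    unfolding mahler_measure_def zero by measurable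
qed

text \<open>Almost surely the vector of the X k is one of the sign vectors, and each of these has probability
  1 / 2^n by independence. So an event that forces Q on this vector is at most as likely as Q.\<close>

lemma (in prob_space) prob_le_sign_mean:
  fixes X :: "nat \<Rightarrow> 'a \<Rightarrow> real"
  assumes n: "0 < n" and indep: "indep_vars (\<lambda>_. borel) X {..<n}"
    and plus: "\<And>k. k < n \<Longrightarrow> prob {\<omega> \<in> space M. X k \<omega> = 1} = 1 / 2"
    and minus: "\<And>k. k < n \<Longrightarrow> prob {\<omega> \<in> space M. X k \<omega> = -1} = 1 / 2"
    and B: "B \<in> events"
    and bad: "\<And>\<omega> x. \<omega> \<in> B \<Longrightarrow> x \<in> signs n \<Longrightarrow> (\<And>k. k < n \<Longrightarrow> X k \<omega> = x k) \<Longrightarrow> Q x"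
  shows "prob B \<le> sign_mean n (\<lambda>x. if Q x then 1 else 0)"
proof -
  have rv: "X k \<in> borel_measurable M" if "k < n" for k
    using indep that by (auto simp: indep_vars_def2)
  define E where "E x = (\<Inter>k\<in>{..<n}. X k -` {x k} \<inter> space M)" for x
  have E_sets: "E x \<in> events" for x
    unfolding E_def using n rv by (intro sets.finite_INT measurable_sets[of _ M borel]) auto
  have E_prob: "prob (E x) = 1 / 2 ^ n" if x: "x \<in> signs n" for x
  proof -
    have "prob (E x) = (\<Prod>k\<in>{..<n}. prob (X k -` {x k} \<inter> space M))"
      unfolding E_def by (rule indep_varsD_finite[OF indep]) (use n in auto)
    also have "\<dots> = (\<Prod>k\<in>{..<n}. 1 / 2)"
    proof (rule prod.cong[OF refl])
      fix k assume k: "k \<in> {..<n}"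
      have "X k -` {x k} \<inter> space M = {\<omega> \<in> space M. X k \<omega> = x k}" by auto
      then show "prob (X k -` {x k} \<inter> space M) = 1 / 2"
        using signs_cases[OF x, of k] plus[of k] minus[of k] k by auto
    qed
    finally show ?thesis by (simp add: power_one_over)
  qed
  have disj: "disjoint_family_on E (signs n)"
  proof (unfold disjoint_family_on_def, intro ballI impI)
    fix x y assume xy: "x \<in> signs n" "y \<in> signs n" "x \<noteq> y"
    then obtain k where "x k \<noteq> y k" by blast
    then have "k < n" using xy by (auto simp: signs_def PiE_iff extensional_def)
    then show "E x \<inter> E y = {}" using \<open>x k \<noteq> y k\<close> by (auto simp: E_def)
  qed
  have "prob (\<Union>x\<in>signs n. E x) = (\<Sum>x\<in>signs n. prob (E x))"
    using E_sets disj by (intro finite_measure_finite_Union) auto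
  also have "\<dots> = 1" by (simp add: E_prob card_signs)
  finally have "AE \<omega> in M. \<omega> \<in> (\<Union>x\<in>signs n. E x)"
    using E_sets by (subst (asm) prob_eq_1) auto
  then have "prob B \<le> prob (\<Union>x\<in>{x \<in> signs n. Q x}. E x)"
  proof (intro finite_measure_mono_AE)
    show "AE \<omega> in M. \<omega> \<in> B \<longrightarrow> \<omega> \<in> (\<Union>x\<in>{x \<in> signs n. Q x}. E x)"
      if "AE \<omega> in M. \<omega> \<in> (\<Union>x\<in>signs n. E x)"
      using that
    proof eventually_elim
      case (elim \<omega>)
      then obtain x where x: "x \<in> signs n" "\<omega> \<in> E x" by blast
      then have "X k \<omega> = x k" if "k < n" for k
        using that unfolding E_def by blast
      then show ?case using bad x by blast
    qed
  qed (use E_sets in auto)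
  also have "\<dots> \<le> (\<Sum>x\<in>{x \<in> signs n. Q x}. prob (E x))"
    using E_sets by (intro finite_measure_subadditive_finite) auto
  also have "\<dots> = (\<Sum>x\<in>{x \<in> signs n. Q x}. 1 / 2 ^ n)"
    by (intro sum.cong refl E_prob) auto
  also have "\<dots> = sign_mean n (\<lambda>x. if Q x then 1 else 0)"
    by (simp add: sign_mean_def sum.If_cases Int_def)
  finally show ?thesis .
qed

theorem mainTheorem3:
  fixes M :: "nat \<Rightarrow> 'a measure"
    and X :: "nat \<Rightarrow> nat \<Rightarrow> 'a \<Rightarrow> real"
  assumes prob: "\<And>n. n \<ge> 2 \<Longrightarrow> prob_space (M n)"
    and indep: "\<And>n. n \<ge> 2 \<Longrightarrow> prob_space.indep_vars (M n) (\<lambda>_. borel) (X n) {..<n}"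
    and plus: "\<And>n k. n \<ge> 2 \<Longrightarrow> k < n \<Longrightarrow>
                 measure (M n) {\<omega> \<in> space (M n). X n k \<omega> = 1} = 1 / 2"
    and minus: "\<And>n k. n \<ge> 2 \<Longrightarrow> k < n \<Longrightarrow>
                 measure (M n) {\<omega> \<in> space (M n). X n k \<omega> = -1} = 1 / 2"
  shows "tendsto_in_probability M
           (\<lambda>n \<omega>. mahler_measure (random_poly n (X n) \<omega>) / sqrt (real n))
           (exp (- euler_mascheroni / 2))"
proof -
  define Y where "Y n \<omega> = mahler_measure (random_poly n (X n) \<omega>) / sqrt (real n)" for n \<omega>
  have meas: "Y n \<in> borel_measurable (M n)" if n: "2 \<le> n" for n
  proof -
    interpret prob_space "M n" by (rule prob[OF n])
    have "X n k \<in> borel_measurable (M n)" if "k < n" for k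
      using indep[OF n] that by (auto simp: indep_vars_def2)
    then show ?thesis
      unfolding Y_def by (intro borel_measurable_divide measurable_mahler_measure) auto
  qed
  have "(\<lambda>n. measure (M n) {\<omega> \<in> space (M n). \<bar>Y n \<omega> - exp (- euler_mascheroni / 2)\<bar> > \<epsilon>}) \<longlonglongrightarrow> 0"
    if \<epsilon>: "0 < \<epsilon>" for \<epsilon> :: real
  proof -
    have "isCont (\<lambda>l. exp (l / 2)) (- euler_mascheroni :: real)" by (intro continuous_intros) simp
    then obtain \<delta> where \<delta>: "0 < \<delta>"
        "\<And>l. \<bar>l - (- euler_mascheroni)\<bar> < \<delta> \<Longrightarrow> \<bar>exp (l / 2) - exp (- euler_mascheroni / 2)\<bar> < \<epsilon>"
      using \<epsilon> unfolding continuous_at_eps_delta by (auto simp: dist_real_def)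
    have le: "measure (M n) {\<omega> \<in> space (M n). \<bar>Y n \<omega> - exp (- euler_mascheroni / 2)\<bar> > \<epsilon>}
        \<le> sign_mean n (\<lambda>x. \<bar>log_mean n x + euler_mascheroni\<bar>) / \<delta>" if n: "6 \<le> n" for n
    proof -
      have n2: "2 \<le> n" using n by simp
      interpret prob_space "M n" by (rule prob[OF n2])
      note [measurable] = meas[OF n2]
      have "prob {\<omega> \<in> space (M n). \<bar>Y n \<omega> - exp (- euler_mascheroni / 2)\<bar> > \<epsilon>}
          \<le> sign_mean n (\<lambda>x. if \<delta> \<le> \<bar>log_mean n x + euler_mascheroni\<bar> then 1 else 0)"
      proof (rule prob_le_sign_mean[OF _ indep[OF n2] plus[OF n2] minus[OF n2]])
        fix \<omega> x assume \<omega>: "\<omega> \<in> {\<omega> \<in> space (M n). \<bar>Y n \<omega> - exp (- euler_mascheroni / 2)\<bar> > \<epsilon>}"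
          and x: "x \<in> signs n" "\<And>k. k < n \<Longrightarrow> X n k \<omega> = x k"
        have "Y n \<omega> = exp (log_mean n x / 2)"
          unfolding Y_def by (rule mahler_measure_random_poly) (use x n in auto)
        then show "\<delta> \<le> \<bar>log_mean n x + euler_mascheroni\<bar>"
          using \<omega> \<delta>(2)[of "log_mean n x"] by fastforce
      qed (use n in auto)
      also have "\<dots> \<le> sign_mean n (\<lambda>x. \<bar>log_mean n x + euler_mascheroni\<bar> / \<delta>)"
        using \<delta>(1) by (intro sign_mean_mono) (auto simp: field_simps)
      also have "\<dots> = sign_mean n (\<lambda>x. \<bar>log_mean n x + euler_mascheroni\<bar>) / \<delta>"
        by (rule sign_mean_divide)
      finally show ?thesis .
    qed
    have "(\<lambda>n. sign_mean n (\<lambda>x. \<bar>log_mean n x + euler_mascheroni\<bar>) / \<delta>) \<longlonglongrightarrow> 0 / \<delta>"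
      using \<delta>(1) by (intro tendsto_divide tendsto_const log_mean_tendsto_L1) auto
    then have "(\<lambda>n. sign_mean n (\<lambda>x. \<bar>log_mean n x + euler_mascheroni\<bar>) / \<delta>) \<longlonglongrightarrow> 0" by simp
    then show ?thesis
    proof (rule Lim_null_comparison[rotated])
      show "\<forall>\<^sub>F n in sequentially. norm (measure (M n) {\<omega> \<in> space (M n). \<bar>Y n \<omega> - exp (- euler_mascheroni / 2)\<bar> > \<epsilon>})
          \<le> sign_mean n (\<lambda>x. \<bar>log_mean n x + euler_mascheroni\<bar>) / \<delta>"
        using eventually_ge_at_top[of 6] by eventually_elim (use le in simp)
    qed
  qed
  moreover have "\<forall>\<^sub>F n in sequentially. Y n \<in> borel_measurable (M n)"
    using eventually_ge_at_top[of 2] by eventually_elim (rule meas)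
  ultimately show ?thesis
    unfolding tendsto_in_probability_def Y_def[symmetric] by blast
qed

end
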